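(* Let $T$ be a (finite) tree that is not isomorphic to $P_2$ or to $P_3$. Then there is no perfect state transfer on $T$; that is, there do not exist distinct vertices $u, v$ of $T$ and a time $\tau \in \mathbb{R}$ such that $|H_T(\tau)_{u,v}| = 1$.
   Context: For a finite simple graph $X$ with adjacency matrix $A$ (a real symmetric $0/1$ matrix with rows and columns indexed by the vertex set $V(X)$), define $H_X(t) = \exp(iAt)$ for real $t$, where $\exp$ is the matrix exponential and $i = \sqrt{-1}$. There is a perfect state transfer (PST) between distinct vertices $u$ and $v$ of $X$ at time $\tau$ if $|H_X(\tau)_{u,v}| = 1$, where $H_X(\tau)_{u,v}$ denotes the $(u,v)$-entry of $H_X(\tau)$. A PST is said to occur on $X$ if there is a PST between some two distinct vertices of $X$ at some time $\tau$. $P_n$ denotes the path graph on $n$ vertices. *)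

theory Defs
  imports
    "HOL-Analysis.Analysis"
    "Graph_Theory.Digraph_Component"
    "Graph_Theory.Digraph_Isomorphism"
begin

text \<open>
  A finite simple graph is a \<^locale>\<open>pair_graph\<close>: a finite loopless digraph without parallel arcs whose
  arc relation is symmetric, so that an edge is a pair of opposite arcs. Matrices indexed by
  vertices are elements of \<^typ>\<open>complex ^ 'v ^ 'v\<close>, where the vertex set is all of the finite
  type \<^typ>\<open>'v\<close>; the following predicate records this convention.
\<close>

definition simple_graph :: "'v::finite pair_pre_digraph \<Rightarrow> bool" where
  "simple_graph X \<longleftrightarrow> pair_graph X \<and> pverts X = UNIV"

text \<open>
  The predicate \<^const>\<open>tree\<close> of \<^theory>\<open>Graph_Theory.Digraph_Component\<close> is not usable here: it
  counts a pair of opposite arcs as a cycle of length 2, hence rejects every symmetric graph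
  with an edge. The cycles of a simple graph are those of length at least 3.
\<close>

definition undirected_tree :: "'v pair_pre_digraph \<Rightarrow> bool" where
  "undirected_tree X \<longleftrightarrow>
     Digraph_Component.connected (with_proj X) \<and>
     \<not> (\<exists>p. pre_digraph.cycle (with_proj X) p \<and> 3 \<le> length p)"

definition path_graph :: "nat \<Rightarrow> nat pair_pre_digraph" where
  "path_graph n =
     \<lparr> pverts = {..<n}, parcs = {(i, j). i < n \<and> j < n \<and> (j = Suc i \<or> i = Suc j)} \<rparr>"

definition adjacency_matrix :: "'v::finite pair_pre_digraph \<Rightarrow> real ^ 'v ^ 'v" where
  "adjacency_matrix X = (\<chi> u v. if (u, v) \<in> parcs X then 1 else 0)"

text \<open>
  The class operations \<open>*\<close>, \<open>^\<close> on \<^typ>\<open>complex ^ 'v ^ 'v\<close> are componentwise, so powers are iterated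
  matrix products.
\<close>

definition matrix_power :: "complex ^ 'v ^ 'v \<Rightarrow> nat \<Rightarrow> complex ^ 'v ^ 'v::finite" where
  "matrix_power M k = (((**) M) ^^ k) (mat 1)"

definition matrix_exp :: "complex ^ 'v ^ 'v \<Rightarrow> complex ^ 'v ^ 'v::finite" where
  "matrix_exp M = (\<Sum>k. matrix_power M k /\<^sub>R fact k)"

definition transition_matrix :: "'v::finite pair_pre_digraph \<Rightarrow> real \<Rightarrow> complex ^ 'v ^ 'v" where
  "transition_matrix X t =
     matrix_exp (\<chi> u v. \<i> * complex_of_real (adjacency_matrix X $ u $ v) * complex_of_real t)"

definition perfect_state_transfer ::
    "'v::finite pair_pre_digraph \<Rightarrow> 'v \<Rightarrow> 'v \<Rightarrow> real \<Rightarrow> bool" where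
  "perfect_state_transfer X u v \<tau> \<longleftrightarrow> u \<noteq> v \<and> cmod (transition_matrix X \<tau> $ u $ v) = 1"

end

theory Submission
  imports Defs "HOL-Computational_Algebra.Fundamental_Theorem_Algebra"
begin

text \<open>
  Let \<open>\<psi>(t) = exp(iAt) e\<^sub>a\<close> arrive at \<open>b \<noteq> a\<close> at time \<open>\<tau>\<close>, and let \<open>S\<close> be the set of eigenvalues that
  occur in \<open>e\<^sub>a\<close>. A tree is bipartite, so \<open>\<psi>(-\<tau>) = \<plusminus>\<psi>(\<tau>)\<close>, with sign \<open>+\<close> iff \<open>a\<close> and \<open>b\<close> have the same
  colour. Hence \<open>exp(2i\<tau>\<theta>) = \<plusminus>1\<close> for \<open>\<theta> \<in> S\<close>, and \<open>S\<close> consists of integer multiples \<open>h n(\<theta>)\<close> of one real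
  \<open>h > 0\<close>, with the \<open>n(\<theta>)\<close> without common divisor; the transfer already takes place at time \<open>\<pi>/h\<close>
  (sign \<open>+\<close>) or \<open>\<pi>/(2h)\<close> (sign \<open>-\<close>). Integrality of \<open>A\<close> makes \<open>h\<^sup>2\<close> a positive integer and, for the
  sign \<open>+\<close>, an argument modulo 2 excludes \<open>h = 1\<close>.

  On the other hand a transfer cannot be fast. Across one bridge, the probability \<open>P\<close> of the far side
  satisfies \<open>|q'| \<le> 2 \<surd>(1 - q\<^sup>2)\<close> for \<open>q = 2P - 1\<close>, so the transfer takes time at least \<open>\<pi>/2\<close>; across
  two consecutive bridges the difference \<open>q\<close> of the probabilities of the two outer parts satisfies
  \<open>|q'| \<le> \<surd>2 \<surd>(1 - q\<^sup>2)\<close>, so the time is at least \<open>\<pi>/\<surd>2\<close>. Comparing, \<open>h = 1\<close> for different colours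
  and \<open>h = \<surd>2\<close> for equal ones. Both are cases of equality, where \<open>\<psi>\<close> never leaves the ends of the
  bridges, and so the tree has no other vertices.
\<close>

section \<open>Bridges of a tree\<close>

text \<open>Acyclicity enters only as \<open>E_bridge\<close>: deleting an edge separates its ends.
  All later arguments cut the tree at an edge, so this form serves them directly.\<close>

locale tree_relation =
  fixes E :: "('v::finite \<times> 'v) set"
  assumes E_sym: "(x, y) \<in> E \<Longrightarrow> (y, x) \<in> E"
    and E_irrefl: "(x, x) \<notin> E"
    and E_connected: "(x, y) \<in> E\<^sup>*"
    and E_bridge: "(x, y) \<in> E \<Longrightarrow> (y, x) \<notin> (E - {(x, y), (y, x)})\<^sup>*"
begin

definition side :: "'v \<Rightarrow> 'v \<Rightarrow> 'v set" where
  "side x y = {w. (y, w) \<in> (E - {(x, y), (y, x)})\<^sup>*}"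

lemma head_in_side [simp]: "y \<in> side x y"
  by (simp add: side_def)

lemma tail_notin_side: "(x, y) \<in> E \<Longrightarrow> x \<notin> side x y"
  using E_bridge by (simp add: side_def)

text \<open>An edge leaving \<open>side x y\<close> must be the deleted one, since any other would
  extend the reachable set; as \<open>x\<close> lies outside, it is traversed from \<open>y\<close>
  to \<open>x\<close>.\<close>

lemma side_crossing:
  assumes "(x, y) \<in> E" "(p, q) \<in> E" "p \<in> side x y" "q \<notin> side x y"
  shows "p = y" "q = x"
proof -
  have "(p, q) \<notin> E - {(x, y), (y, x)}"
    using assms(3,4) by (auto simp: side_def intro: rtrancl_into_rtrancl)
  moreover have "p \<noteq> x"
    using tail_notin_side[OF assms(1)] assms(3) by auto
  ultimately show "p = y" "q = x" using assms(2) by auto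
qed

text \<open>If \<open>w\<close> lies in \<open>side x y\<close>, the edge from \<open>w\<close> to
  \<open>x\<close> leaves that side, so \<open>w = y\<close>; otherwise the edge from
  \<open>y\<close> to \<open>w\<close> does, so \<open>w = x\<close>. Both contradict
  irreflexivity.\<close>

lemma no_triangle:
  assumes "(x, y) \<in> E" "(w, x) \<in> E" "(w, y) \<in> E" shows False
proof -
  have "w \<noteq> x" "w \<noteq> y" using assms E_irrefl by auto
  then show False
    using side_crossing(1)[OF assms(1,2)] side_crossing(2)[OF assms(1) E_sym[OF assms(3)]]
      tail_notin_side[OF assms(1)] by auto
qed

lemma side_cover:
  assumes "(x, y) \<in> E" shows "w \<in> side x y \<or> w \<in> side y x"
  using E_connected[of y w]
proof (induction rule: rtrancl_induct)
  case (step w w')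
  then show ?case
    using side_crossing[OF assms] side_crossing[OF E_sym[OF assms]] by (metis head_in_side)
qed auto

lemma side_disjoint:
  assumes "(x, y) \<in> E" "w \<in> side x y" shows "w \<notin> side y x"
proof
  let ?R = "E - {(x, y), (y, x)}"
  assume "w \<in> side y x"
  then have "(x, w) \<in> ?R\<^sup>*" by (simp add: side_def insert_commute)
  moreover have "sym ?R" using E_sym by (auto simp: sym_def)
  ultimately have "(w, x) \<in> ?R\<^sup>*" by (meson sym_rtrancl symD)
  then have "(y, x) \<in> ?R\<^sup>*" using assms(2) by (simp add: side_def)
  then show False using E_bridge[OF assms(1)] by simp
qed

text \<open>The colour is the parity of the distance from an arbitrary root
  \<open>r\<close>.\<close>

lemma two_colouring: "\<exists>c :: 'v \<Rightarrow> bool. \<forall>(x, y) \<in> E. c x \<noteq> c y"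
proof -
  fix r :: 'v
  \<comment> \<open>\<open>F w\<close> collects the edges, oriented away from \<open>r\<close>, that
    separate \<open>r\<close> from \<open>w\<close>, so its size is the distance. Crossing an edge
    away from \<open>r\<close> adds just that edge, because every other edge has both ends on one of
    its sides.\<close>
  define F where "F w = {(x, y). (x, y) \<in> E \<and> r \<notin> side x y \<and> w \<in> side x y}" for w
  have step: "card (F q) = Suc (card (F p))" if pq: "(p, q) \<in> E" and r: "r \<notin> side p q" for p q
  proof -
    have r': "r \<in> side q p" using side_cover[OF pq] r by blast
    have same: "p \<in> side x y \<longleftrightarrow> q \<in> side x y"
      if "(x, y) \<in> E" "(x, y) \<noteq> (p, q)" "(x, y) \<noteq> (q, p)" for x y
      using side_crossing[OF that(1) pq] side_crossing[OF that(1) E_sym[OF pq]] that by blast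
    have "F q = insert (p, q) (F p)"
    proof (intro set_eqI)
      fix e :: "'v \<times> 'v"
      obtain x y where e: "e = (x, y)" by fastforce
      consider "e = (p, q)" | "e = (q, p)" "e \<noteq> (p, q)" | "e \<noteq> (p, q)" "e \<noteq> (q, p)" by blast
      then show "e \<in> F q \<longleftrightarrow> e \<in> insert (p, q) (F p)"
      proof cases
        case 3
        then show ?thesis using same[of x y] by (auto simp: e F_def)
      qed (use r r' pq in \<open>auto simp: F_def\<close>)
    qed
    moreover have "(p, q) \<notin> F p"
      using tail_notin_side[OF pq] by (auto simp: F_def)
    ultimately show ?thesis by simp
  qed
  have "even (card (F x)) \<noteq> even (card (F y))" if "(x, y) \<in> E" for x y
    using step[OF that] step[OF E_sym[OF that]] side_disjoint[OF that, of r] by (metis even_Suc)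
  then show ?thesis by (intro exI[of _ "\<lambda>w. even (card (F w))"]) auto
qed

text \<open>Induction along a walk from \<open>a\<close>: a side \<open>side a y\<close> can be left
  only back to \<open>a\<close>, and the next edge then selects the new neighbour.\<close>

lemma first_edge:
  assumes "a \<noteq> b"
  obtains y where "(a, y) \<in> E" "b \<in> side a y"
proof -
  have "b = a \<or> (\<exists>y. (a, y) \<in> E \<and> b \<in> side a y)"
    using E_connected[of a b]
  proof (induction rule: rtrancl_induct)
    case (step b b')
    then show ?case using side_crossing(2)[of a _ b b'] by (metis head_in_side)
  qed simp
  then show thesis using assms that by auto
qed

lemma first_two_edges:
  assumes "a \<noteq> b" "(a, b) \<notin> E"
  obtains y z where "(a, y) \<in> E" "(y, z) \<in> E" "b \<in> side y z" "side y z \<subseteq> side a y" "a \<noteq> z"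
proof -
  obtain y where y: "(a, y) \<in> E" "b \<in> side a y" using first_edge assms(1) by blast
  moreover from y assms(2) have "y \<noteq> b" by auto
  ultimately obtain z where z: "(y, z) \<in> E" "b \<in> side y z" using first_edge by blast
  have az: "a \<noteq> z" using side_disjoint y z by blast
  \<comment> \<open>A walk inside \<open>side y z\<close> never visits \<open>y\<close>, the only
    vertex from which \<open>side a y\<close> can be left.\<close>
  have "w \<in> side a y" if "w \<in> side y z" for w
  proof -
    have "(z, w) \<in> (E - {(y, z), (z, y)})\<^sup>*" using that by (simp add: side_def)
    then show ?thesis
    proof (induction rule: rtrancl_induct)
      case base
      show ?case using side_crossing(2)[OF y(1) z(1)] az by auto
    next
      case (step w w')
      have "w \<in> side y z" using step(1) by (simp add: side_def)
      then have "w \<noteq> y" using tail_notin_side[OF z(1)] by auto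
      then show ?case using side_crossing(1)[OF y(1)] step by blast
    qed
  qed
  then show thesis using that y z az by blast
qed

end

text \<open>A route from \<open>y\<close> to \<open>x\<close> that avoids their edge would be closed
  by this edge to a cycle of length at least 3.\<close>

lemma symmetric_tree_relation:
  fixes T :: "'v::finite pair_pre_digraph"
  assumes "simple_graph T" "undirected_tree T"
  shows "tree_relation (parcs T)"
proof -
  have verts: "pverts T = UNIV" and pg: "pair_graph T" using assms(1) by (auto simp: simple_graph_def)
  interpret pair_graph T by (rule pg)
  have irr: "(x, x) \<notin> parcs T" for x using no_loops' by blast
  show ?thesis
  proof
    fix x y assume "(x, y) \<in> parcs T" then show "(y, x) \<in> parcs T" by (rule arcs_symmetric)
  next
    fix x show "(x, x) \<notin> parcs T" by (rule irr)
  next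
    fix x y
    have "strongly_connected (with_proj T)"
      using assms(2) symmetric_connected_imp_strongly_connected[OF sym_arcs]
      by (auto simp: undirected_tree_def)
    then have "x \<rightarrow>\<^sup>*\<^bsub>with_proj T\<^esub> y" using verts by (auto simp: strongly_connected_def)
    then show "(x, y) \<in> (parcs T)\<^sup>*"
      by (auto simp: reachable_def intro: rtrancl_on_rtranclI)
  next
    fix x y assume xy: "(x, y) \<in> parcs T"
    show "(y, x) \<notin> (parcs T - {(x, y), (y, x)})\<^sup>*"
    proof
      let ?H = "\<lparr>pverts = UNIV, parcs = parcs T - {(x, y), (y, x)}\<rparr> :: 'v pair_pre_digraph"
      assume R: "(y, x) \<in> (parcs T - {(x, y), (y, x)})\<^sup>*"
      interpret H: pair_wf_digraph ?H by unfold_locales auto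
      have "y \<rightarrow>\<^sup>*\<^bsub>with_proj ?H\<^esub> x" 
        using rtrancl_consistent_rtrancl_on[OF R, of UNIV] by (simp add: reachable_def)
      then obtain p where p: "H.apath y p x" using H.reachable_apath by blast
      have aw: "awalk y p x" and dist: "distinct (pawalk_verts y p)"
        using p verts by (auto simp: H.apath_def H.awalk_def awalk_def)
      have "x \<noteq> y" using xy irr by auto
      \<comment> \<open>A shorter path is empty, forcing \<open>x = y\<close>, or is the single arc
        from \<open>y\<close> to \<open>x\<close>, which has been deleted.\<close>
      have len: "2 \<le> length p"
      proof (rule ccontr)
        assume "\<not> 2 \<le> length p"
        then consider "p = []" | e where "p = [e]" by (cases p; cases "tl p") auto
        then show False
          using p \<open>x \<noteq> y\<close> by cases (auto simp: H.apath_def H.awalk_def)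
      qed
      have "cycle ((x, y) # p)"
        unfolding cycle_def using aw dist xy verts 
        by (intro exI[of _ x]) (auto simp: awalk_Cons_iff)
      then show False using assms(2) len by (auto simp: undirected_tree_def)
    qed
  qed
qed

section \<open>Spectral decomposition of Hermitian matrices\<close>

definition cdot :: "complex ^ 'n \<Rightarrow> complex ^ 'n \<Rightarrow> complex" where
  "cdot x y = (\<Sum>i\<in>UNIV. cnj (x $ i) * y $ i)"

lemma cdot_diff_right: "cdot x (y - z) = cdot x y - cdot x z"
  by (simp add: cdot_def algebra_simps sum_subtractf)

lemma cdot_scale_right: "cdot x (c *s y) = c * cdot x y"
  by (simp add: cdot_def algebra_simps sum_distrib_left)

lemma cdot_scale_left: "cdot (c *s x) y = cnj c * cdot x y"
  by (simp add: cdot_def algebra_simps sum_distrib_left)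

lemma cdot_sum_right: "cdot x (\<Sum>i\<in>I. f i) = (\<Sum>i\<in>I. cdot x (f i))"
  by (simp add: cdot_def sum_component sum_distrib_left) (rule sum.swap)

lemma cdot_zero_right [simp]: "cdot x 0 = 0"
  by (simp add: cdot_def)

lemma cdot_self: "cdot x x = of_real (\<Sum>i\<in>UNIV. (cmod (x $ i))\<^sup>2)"
  unfolding cdot_def of_real_sum
  by (intro sum.cong refl) (metis complex_norm_square mult.commute of_real_power)

lemma cdot_self_eq_0 [simp]: "cdot x x = 0 \<longleftrightarrow> x = 0"
  by (simp add: cdot_self sum_nonneg_eq_0_iff vec_eq_iff del: of_real_sum)

lemma matrix_vector_mult_sum:
  fixes M :: "complex ^ 'n ^ 'm"
  shows "M *v (\<Sum>i\<in>I. f i) = (\<Sum>i\<in>I. M *v f i)"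
  by (induction I rule: infinite_finite_induct) (auto simp: matrix_vector_right_distrib)

locale hermitian_matrix =
  fixes A :: "complex ^ 'n ^ 'n"
  assumes hermitian: "cnj (A $ i $ j) = A $ j $ i"
begin

lemma cdot_adjoint: "cdot (A *v x) y = cdot x (A *v y)"
proof -
  have "cdot (A *v x) y = (\<Sum>i\<in>UNIV. \<Sum>j\<in>UNIV. A $ j $ i * cnj (x $ j) * y $ i)"
    by (simp add: cdot_def matrix_vector_mult_def sum_distrib_right hermitian)
  also have "\<dots> = (\<Sum>j\<in>UNIV. \<Sum>i\<in>UNIV. A $ j $ i * cnj (x $ j) * y $ i)"
    by (rule sum.swap)
  also have "\<dots> = cdot x (A *v y)"
    by (simp add: cdot_def matrix_vector_mult_def sum_distrib_left mult_ac)
  finally show ?thesis .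
qed

definition eigen :: "real \<Rightarrow> complex ^ 'n \<Rightarrow> bool" where
  "eigen \<theta> x \<longleftrightarrow> A *v x = of_real \<theta> *s x"

lemma eigenvalue_real:
  assumes "A *v x = c *s x" "x \<noteq> 0" shows "c \<in> \<real>"
proof -
  have "cnj c * cdot x x = c * cdot x x"
    using cdot_adjoint[of x x] by (simp add: assms(1) cdot_scale_left cdot_scale_right)
  then have "cnj c = c" using assms(2) by simp
  then show ?thesis by (simp add: Reals_cnj_iff)
qed

lemma eigen_orthogonal:
  assumes "eigen \<theta> x" "eigen \<mu> y" "\<theta> \<noteq> \<mu>" shows "cdot x y = 0"
proof -
  have "of_real \<theta> * cdot x y = of_real \<mu> * cdot x y"
    using cdot_adjoint[of x y] assms(1,2)
    by (simp add: eigen_def cdot_scale_left cdot_scale_right)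
  then show ?thesis using assms(3) by simp
qed

text \<open>Pairing the vanishing sum with \<open>y \<mu>\<close> kills all other terms by
  orthogonality and leaves the squared norm.\<close>

lemma eigen_independent:
  assumes "finite S" "\<And>\<theta>. \<theta> \<in> S \<Longrightarrow> eigen \<theta> (y \<theta>)" "(\<Sum>\<theta>\<in>S. y \<theta>) = 0" "\<mu> \<in> S"
  shows "y \<mu> = 0"
proof -
  have "0 = cdot (y \<mu>) (\<Sum>\<theta>\<in>S. y \<theta>)" using assms(3) by simp
  also have "\<dots> = (\<Sum>\<theta>\<in>S. if \<theta> = \<mu> then cdot (y \<mu>) (y \<mu>) else 0)"
    unfolding cdot_sum_right using eigen_orthogonal[OF assms(2)[OF assms(4)] assms(2)] by (intro sum.cong) auto
  also have "\<dots> = cdot (y \<mu>) (y \<mu>)" using assms(1,4) by simp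
  finally show ?thesis by simp
qed

section \<open>Polynomials in a Hermitian matrix and the eigenvector decomposition\<close>

definition poly_action :: "complex poly \<Rightarrow> complex ^ 'n \<Rightarrow> complex ^ 'n" where
  "poly_action p w = (\<Sum>i\<le>degree p. coeff p i *s ((*v) A ^^ i) w)"

text \<open>One step of Horner's scheme, with \<open>A\<close> moved onto the vector; this makes the
  laws below provable by induction on the polynomial with the vector arbitrary.\<close>

lemma poly_action_pCons: "poly_action (pCons c p) w = c *s w + poly_action p (A *v w)"
  by (simp add: poly_action_def sum.atMost_Suc_shift funpow_Suc_right del: sum.atMost_Suc funpow.simps(2))

lemma poly_action_0 [simp]: "poly_action 0 w = 0"
  by (simp add: poly_action_def)

lemma poly_action_add: "poly_action (p + q) w = poly_action p w + poly_action q w"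
  by (induction p q arbitrary: w rule: poly_induct2) (simp_all add: poly_action_pCons algebra_simps)

lemma poly_action_smult: "poly_action (smult c p) w = c *s poly_action p w"
  by (induction p arbitrary: w) (simp_all add: poly_action_pCons algebra_simps)

lemma poly_action_diff: "poly_action (p - q) w = poly_action p w - poly_action q w"
  using poly_action_add[of "p - q" q w] by (simp add: algebra_simps)

lemma poly_action_diff_vec: "poly_action p (v - w) = poly_action p v - poly_action p w"
  by (induction p arbitrary: v w) (simp_all add: poly_action_pCons algebra_simps matrix_vector_mult_diff_distrib)

lemma poly_action_scale_vec: "poly_action p (c *s w) = c *s poly_action p w"
  by (induction p arbitrary: w)
    (simp_all add: poly_action_pCons algebra_simps matrix_vector_mult_scaleR vector_scalar_commute)

lemma poly_action_factor: "poly_action ([:-\<mu>, 1:] * q) w = poly_action q (A *v w - \<mu> *s w)"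
  by (simp add: poly_action_diff poly_action_smult poly_action_pCons poly_action_diff_vec poly_action_scale_vec)

lemma scale_of_real: "complex_of_real c *s v = c *\<^sub>R v"
  by (simp add: vec_eq_iff complex_eq_iff)

text \<open>With \<open>N\<close> the real dimension, the \<open>N + 1\<close> iterates of
  \<open>w\<close> are linearly dependent, already over the reals.\<close>

lemma annihilating_poly: "\<exists>p. p \<noteq> 0 \<and> poly_action p w = 0"
proof -
  define f where "f i = ((*v) A ^^ i) w" for i
  define N where "N = DIM(complex ^ 'n)"
  have "\<exists>c :: nat \<Rightarrow> complex. (\<exists>i\<le>N. c i \<noteq> 0) \<and> (\<Sum>i\<le>N. c i *s f i) = 0"
  proof (cases "inj_on f {..N}")
    case True
    then have "card (f ` {..N}) = Suc N" by (simp add: card_image)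
    then have "dependent (f ` {..N})"
      using independent_bound[of "f ` {..N}"] by (auto simp: N_def)
    then obtain u where u: "\<exists>v\<in>f ` {..N}. u v \<noteq> 0" "(\<Sum>v\<in>f ` {..N}. u v *\<^sub>R v) = 0"
      by (subst (asm) dependent_finite) auto
    have "(\<Sum>i\<le>N. complex_of_real (u (f i)) *s f i) = (0 :: complex ^ 'n)"
      using u(2) by (simp add: sum.reindex[OF True] scale_of_real)
    then show ?thesis using u(1) by (intro exI[of _ "\<lambda>i. complex_of_real (u (f i))"]) auto
  next
    \<comment> \<open>Coinciding iterates make the image too small for the dimension count, but
      their difference is itself a relation.\<close>
    case False
    then obtain i j where ij: "i \<le> N" "j \<le> N" "i \<noteq> j" "f i = f j" by (auto simp: inj_on_def)
    have "(\<Sum>k\<le>N. (if k = i then 1 else if k = j then -1 else 0 :: complex) *s f k)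
        = (\<Sum>k\<in>{i, j}. (if k = i then 1 else if k = j then -1 else 0 :: complex) *s f k)"
      using ij by (intro sum.mono_neutral_right) auto
    also have "\<dots> = 0" using ij by simp
    finally show ?thesis
      using ij(1) by (intro exI[of _ "\<lambda>k. if k = i then 1 else if k = j then -1 else 0"]) auto
  qed
  then obtain c :: "nat \<Rightarrow> complex" and i
    where c: "i \<le> N" "c i \<noteq> 0" "(\<Sum>i\<le>N. c i *s f i) = 0" by auto
  define p where "p = Poly (map c [0..<Suc N])"
  have cf: "coeff p k = (if k \<le> N then c k else 0)" for k
    by (auto simp: p_def nth_default_def simp del: upt_Suc)
  then have deg: "degree p \<le> N" by (intro degree_le) auto
  have "poly_action p w = (\<Sum>k\<le>N. coeff p k *s f k)"
    unfolding poly_action_def f_def using deg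
    by (intro sum.mono_neutral_left) (auto simp: coeff_eq_0)
  also have "\<dots> = 0" using c(3) by (simp add: cf)
  finally show ?thesis using cf[of i] c(1,2) by (intro exI[of _ p]) auto
qed

text \<open>Induction on the degree: split off a factor \<open>t - \<mu>\<close>, decompose
  \<open>(A - \<mu>) w\<close> by the hypothesis, and invert \<open>A - \<mu>\<close> on all
  components with eigenvalue other than \<open>\<mu>\<close>. The remainder \<open>y\<close> is an
  eigenvector for \<open>\<mu>\<close> or zero.\<close>

lemma eigen_decomposition_of_annihilated:
  assumes "p \<noteq> 0" "poly_action p w = 0"
  shows "\<exists>S z. finite S \<and> (\<forall>\<theta>\<in>S. eigen \<theta> (z \<theta>)) \<and> w = (\<Sum>\<theta>\<in>S. z \<theta>)"
  using assms
proof (induction "degree p" arbitrary: p w)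
  case 0
  then obtain c where "p = [:c:]" by (metis degree_eq_zeroE)
  with 0 have "w = 0" by (simp add: poly_action_pCons)
  then show ?case by (intro exI[of _ "{}"]) auto
next
  case (Suc n)
  then have "\<not> constant (poly p)" by (simp add: constant_degree)
  then obtain \<mu> where "poly p \<mu> = 0" using fundamental_theorem_of_algebra by blast
  then obtain q where q: "p = [:-\<mu>, 1:] * q" by (metis dvdE poly_eq_0_iff_dvd)
  have q0: "q \<noteq> 0" using Suc.prems q by auto
  then have "degree p = Suc (degree q)" unfolding q by (subst degree_mult_eq) auto
  then have "n = degree q" using Suc.hyps by simp
  from Suc.hyps(1)[OF this q0] Suc.prems(2) obtain S z where Sz: "finite S"
    "\<And>\<theta>. \<theta> \<in> S \<Longrightarrow> eigen \<theta> (z \<theta>)" "A *v w - \<mu> *s w = (\<Sum>\<theta>\<in>S. z \<theta>)"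
    unfolding q poly_action_factor by meson
  define R where "R = {\<theta>\<in>S. complex_of_real \<theta> \<noteq> \<mu>}"
  define z' where "z' \<theta> = (1 / (of_real \<theta> - \<mu>)) *s z \<theta>" for \<theta>
  define y where "y = w - (\<Sum>\<theta>\<in>R. z' \<theta>)"
  have z'_eig: "eigen \<theta> (z' \<theta>)" if "\<theta> \<in> S" for \<theta>
    using Sz(2)[OF that] by (simp add: eigen_def z'_def vector_scalar_commute mult.commute)
  have z'_res: "A *v z' \<theta> - \<mu> *s z' \<theta> = z \<theta>" if "\<theta> \<in> R" for \<theta>
  proof -
    have "A *v z' \<theta> - \<mu> *s z' \<theta> = (of_real \<theta> - \<mu>) *s z' \<theta>"
      using z'_eig[of \<theta>] that by (simp add: R_def eigen_def vector_sub_rdistrib)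
    then show ?thesis using that by (simp add: z'_def R_def)
  qed
  have fin: "finite R" using Sz(1) by (simp add: R_def)
  have "A *v y - \<mu> *s y = (A *v w - \<mu> *s w) - (\<Sum>\<theta>\<in>R. A *v z' \<theta> - \<mu> *s z' \<theta>)"
    by (simp add: y_def matrix_vector_mult_diff_distrib matrix_vector_mult_sum sum_subtractf
        vec.scale_sum_right vec.scale_right_diff_distrib)
  also have "\<dots> = (\<Sum>\<theta>\<in>S. z \<theta>) - (\<Sum>\<theta>\<in>R. z \<theta>)" using Sz(3) z'_res by simp
  also have "\<dots> = (\<Sum>\<theta>\<in>S - R. z \<theta>)" using Sz(1) by (subst sum_diff) (auto simp: R_def)
  finally have res: "A *v y - \<mu> *s y = (\<Sum>\<theta>\<in>S - R. z \<theta>)" .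
  have w: "w = y + (\<Sum>\<theta>\<in>R. z' \<theta>)" by (simp add: y_def)
  show ?case
  proof (cases "\<mu> \<in> \<real>")
    case True
    then obtain m where m: "\<mu> = of_real m" by (auto elim: Reals_cases)
    have SR: "S - R \<subseteq> {m}" by (auto simp: R_def m)
    define r where "r = (\<Sum>\<theta>\<in>S - R. z \<theta>)"
    from SR consider "S - R = {}" | "S - R = {m}" by blast
    then have r_eig: "A *v r = \<mu> *s r"
    proof cases
      case 1
      then have "r = 0" by (simp only: r_def sum.empty)
      then show ?thesis by simp
    next
      case 2
      then have "r = z m" by (simp add: r_def)
      moreover have "m \<in> S" using 2 by blast
      ultimately show ?thesis using Sz(2)[of m] by (simp add: eigen_def m)
    qed
    \<comment> \<open>\<open>r\<close> lies both in the kernel and in the image of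
      \<open>A - \<mu>\<close>; for real \<open>\<mu>\<close> these are orthogonal, so
      \<open>r = 0\<close>. This is where Jordan blocks are excluded.\<close>
    have "cdot r r = cdot r (A *v y) - \<mu> * cdot r y"
      by (simp add: r_def res[symmetric] cdot_diff_right cdot_scale_right)
    also have "\<dots> = 0"
      by (simp add: cdot_adjoint[symmetric] r_eig cdot_scale_left m)
    finally have "r = 0" by simp
    then have "eigen m y" using res by (simp add: r_def eigen_def m)
    have "m \<notin> R" by (simp add: R_def m)
    then have "(\<Sum>\<theta>\<in>insert m R. (z'(m := y)) \<theta>) = y + (\<Sum>\<theta>\<in>R. (z'(m := y)) \<theta>)"
      using fin by simp
    also have "(\<Sum>\<theta>\<in>R. (z'(m := y)) \<theta>) = (\<Sum>\<theta>\<in>R. z' \<theta>)"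
      using \<open>m \<notin> R\<close> by (intro sum.cong) auto
    finally have w_sum: "w = (\<Sum>\<theta>\<in>insert m R. (z'(m := y)) \<theta>)" using w by simp
    have eig: "\<forall>\<theta>\<in>insert m R. eigen \<theta> ((z'(m := y)) \<theta>)"
      using \<open>eigen m y\<close> z'_eig by (auto simp: R_def)
    show ?thesis
      by (rule exI[of _ "insert m R"], rule exI[of _ "z'(m := y)"], intro conjI)
        (simp add: fin, rule eig, rule w_sum)
  next
    case False
    then have "S - R = {}" by (auto simp: R_def)
    then have "A *v y - \<mu> *s y = 0" unfolding res by (simp only: sum.empty)
    then have "y = 0" using eigenvalue_real[of y \<mu>] False by auto
    then show ?thesis using fin w z'_eig by (intro exI[of _ R] exI[of _ z'] conjI) (simp_all add: R_def)
  qed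
qed

theorem eigen_decomposition:
  obtains S z where "finite S" "\<And>\<theta>. \<theta> \<in> S \<Longrightarrow> eigen \<theta> (z \<theta>)" "\<And>\<theta>. \<theta> \<in> S \<Longrightarrow> z \<theta> \<noteq> 0"
    "w = (\<Sum>\<theta>\<in>S. z \<theta>)"
proof -
  obtain p where "p \<noteq> 0" "poly_action p w = 0" using annihilating_poly by blast
  from eigen_decomposition_of_annihilated[OF this] obtain S z
    where Sz: "finite S" "\<forall>\<theta>\<in>S. eigen \<theta> (z \<theta>)" "w = (\<Sum>\<theta>\<in>S. z \<theta>)"
    by blast
  have *: "w = (\<Sum>\<theta>\<in>{\<theta>\<in>S. z \<theta> \<noteq> 0}. z \<theta>)"
    unfolding Sz(3) using Sz(1) by (intro sum.mono_neutral_right) auto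
  show thesis by (rule that[OF _ _ _ *]) (use Sz(1,2) in auto)
qed

end

section \<open>Entries of the matrix exponential\<close>

lemma matrix_power_mult_vec: "matrix_power M k *v x = ((*v) M ^^ k) x"
proof (induction k)
  case (Suc k)
  then show ?case by (simp add: matrix_power_def flip: matrix_vector_mul_assoc)
qed (simp add: matrix_power_def)

context hermitian_matrix begin

text \<open>On each eigenvector component the matrix series becomes the scalar exponential
  series.\<close>

lemma matrix_exp_entry:
  assumes "finite S" "\<And>\<theta>. \<theta> \<in> S \<Longrightarrow> eigen \<theta> (z \<theta>)" "axis u 1 = (\<Sum>\<theta>\<in>S. z \<theta>)"
  shows "matrix_exp (\<chi> i j. \<i> * A $ i $ j * of_real t) $ w $ u
    = (\<Sum>\<theta>\<in>S. exp (\<i> * of_real (t * \<theta>)) * z \<theta> $ w)"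
proof -
  define M where "M = (\<chi> i j. \<i> * A $ i $ j * complex_of_real t)"
  have Mv: "M *v x = (\<i> * of_real t) *s (A *v x)" for x
    by (simp add: M_def matrix_vector_mult_def vec_eq_iff sum_distrib_left mult_ac)
  have entry: "(\<lambda>k. (matrix_power M k /\<^sub>R fact k) $ w $ u)
      sums (\<Sum>\<theta>\<in>S. exp (\<i> * of_real (t * \<theta>)) * z \<theta> $ w)"
    if S: "finite S" "\<And>\<theta>. \<theta> \<in> S \<Longrightarrow> eigen \<theta> (z \<theta>)" "axis u 1 = (\<Sum>\<theta>\<in>S. z \<theta>)"
    for S z w u
  proof -
    have pow: "((*v) M ^^ k) (z \<theta>) = (\<i> * of_real (t * \<theta>)) ^ k *s z \<theta>" if "\<theta> \<in> S" for k \<theta>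
      using S(2)[OF that]
      by (induction k) (simp_all add: Mv eigen_def vector_scalar_commute mult_ac)
    have lin: "((*v) M ^^ k) (\<Sum>\<theta>\<in>S. z \<theta>) = (\<Sum>\<theta>\<in>S. ((*v) M ^^ k) (z \<theta>))" for k
      by (induction k) (simp_all add: matrix_vector_mult_sum)
    have "matrix_power M k $ w $ u = (matrix_power M k *v axis u 1) $ w" for k
      by (simp add: matrix_vector_mult_def axis_def if_distrib cong: if_cong)
    also have "\<dots> k = (\<Sum>\<theta>\<in>S. (\<i> * of_real (t * \<theta>)) ^ k * z \<theta> $ w)" for k
      by (simp add: matrix_power_mult_vec S(3) lin pow)
    finally have eq: "(matrix_power M k /\<^sub>R fact k) $ w $ u
        = (\<Sum>\<theta>\<in>S. ((\<i> * of_real (t * \<theta>)) ^ k /\<^sub>R fact k) * z \<theta> $ w)" for k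
      by (simp add: scaleR_sum_right)
    show ?thesis unfolding eq by (intro sums_sum sums_mult2 exp_converges)
  qed
  \<comment> \<open>The infinite sum of matrices can be evaluated only once all entries converge, so
    every other column is decomposed as well.\<close>
  have "\<exists>L. (\<lambda>k. (matrix_power M k /\<^sub>R fact k) $ w $ u) sums L" for w u
    by (rule eigen_decomposition[of "axis u 1"]) (blast intro: entry)
  then obtain L where L: "\<And>w u. (\<lambda>k. (matrix_power M k /\<^sub>R fact k) $ w $ u) sums L w u" by metis
  have "(\<lambda>k. matrix_power M k /\<^sub>R fact k) sums (\<chi> w u. L w u)"
    unfolding sums_def
    by (intro vec_tendstoI) (use L in \<open>simp add: sums_def\<close>)
  then have "matrix_exp M = (\<chi> w u. L w u)" by (simp add: matrix_exp_def sums_iff)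
  then show ?thesis
    using sums_unique2[OF L entry[OF assms]] by (simp add: M_def)
qed

end

section \<open>Eigenvalues of an integral vector\<close>

text \<open>The case \<open>k = 0\<close> makes \<open>c\<close> a nonzero integer \<open>m\<close>,
  and the denominator \<open>q\<close> of \<open>x\<close> satisfies that \<open>q ^ k\<close>
  divides \<open>m\<close> for all \<open>k\<close>. At \<open>k = \<bar>m\<bar>\<close> this is too
  large unless \<open>q = 1\<close>.\<close>

lemma rational_powers_integral:
  fixes x c :: complex
  assumes "x \<in> \<rat>" "c \<noteq> 0" "\<And>k. x ^ k * c \<in> \<int>" shows "x \<in> \<int>"
proof -
  obtain p q where pq: "q > 0" "coprime p q" "x = of_int p / of_int q"
    using assms(1) by (auto elim: Rats_cases')
  obtain m where m: "c = of_int m" using assms(3)[of 0] by (auto elim: Ints_cases)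
  have dvd: "q ^ k dvd m" for k
  proof -
    obtain j where "x ^ k * c = of_int j" using assms(3) by (auto elim: Ints_cases)
    then have "complex_of_int (p ^ k * m) = of_int (q ^ k * j)"
      using pq(1) by (simp add: pq(3) m power_divide field_simps)
    then have "p ^ k * m = q ^ k * j" by (simp only: of_int_eq_iff)
    then have "q ^ k dvd p ^ k * m" by simp
    moreover have "coprime (q ^ k) (p ^ k)" using pq(2) by (simp add: coprime_commute)
    ultimately show ?thesis by (simp add: coprime_dvd_mult_right_iff)
  qed
  have "m \<noteq> 0" using assms(2) m by simp
  then have le: "q ^ nat \<bar>m\<bar> \<le> \<bar>m\<bar>"
    using dvd_imp_le_int[OF _ dvd] pq(1) by fastforce
  have "q = 1"
  proof (rule ccontr)
    assume "q \<noteq> 1"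
    then have "2 ^ nat \<bar>m\<bar> \<le> q ^ nat \<bar>m\<bar>" using pq(1) by (intro power_mono) auto
    moreover have "\<bar>m\<bar> < 2 ^ nat \<bar>m\<bar>"
      using of_nat_less_two_power[of "nat \<bar>m\<bar>", where 'a = int] by simp
    ultimately show False using le by linarith
  qed
  then show ?thesis by (simp add: pq(3))
qed

lemma common_denominator:
  fixes V :: "complex set"
  assumes "finite V" "V \<subseteq> \<rat>"
  shows "\<exists>D::int. D \<noteq> 0 \<and> (\<forall>s\<in>V. of_int D * s \<in> \<int>)"
  using assms
proof (induction V)
  case (insert s V)
  then obtain D where D: "D \<noteq> 0" "\<forall>s\<in>V. of_int D * s \<in> \<int>" by auto
  obtain p q where pq: "q > 0" "s = of_int p / of_int q"
    using insert.prems by (auto elim: Rats_cases')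
  have "complex_of_int (q * D) * s = of_int (p * D)" using pq by simp
  moreover have "complex_of_int (q * D) * t \<in> \<int>" if "t \<in> V" for t
    using D(2) that Ints_mult[of "of_int q" "of_int D * t"] by (simp add: mult.assoc)
  ultimately show ?case using D(1) pq(1) by (intro exI[of _ "q * D"]) (auto simp del: of_int_mult)
qed (auto intro: exI[of _ 1])

text \<open>Over the rationals \<open>c\<close> and \<open>1\<close> are independent vectors, so
  values on them can be prescribed and extended to all complex numbers.\<close>

lemma rational_linear_functional:
  fixes c :: complex
  assumes "c \<notin> \<rat>"
  obtains f :: "complex \<Rightarrow> complex"
  where "\<And>x y. f (x + y) = f x + f y" "\<And>x m. f (x * of_int m) = f x * of_int m" "f 1 = 1" "f c = 0"
proof -
  let ?scale = "\<lambda>(r :: rat) (x :: complex). of_rat r * x"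
  interpret Q: vector_space ?scale
    by unfold_locales (simp_all add: algebra_simps of_rat_add of_rat_mult)
  interpret QQ: vector_space_pair ?scale ?scale ..
  have "Q.span {1} = range of_rat" by (simp add: Q.span_singleton)
  then have "c \<notin> Q.span {1}" using assms by (simp add: Rats_def)
  then have "Q.independent {c, 1}" by (simp add: Q.independent_insert)
  then obtain g where g: "Vector_Spaces.linear ?scale ?scale g"
      "\<forall>x\<in>{c, 1}. g x = (if x = c then 0 else 1)"
    using QQ.linear_independent_extend[of "{c, 1}" "\<lambda>x. if x = c then 0 else 1"] by auto
  interpret g: Vector_Spaces.linear ?scale ?scale g by (rule g(1))
  have "c \<noteq> 1" using assms by auto
  then have "g 1 = 1" "g c = 0" using g(2) by auto
  moreover have "g (x * of_int m) = g x * of_int m" for x m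
    using g.scale[of "of_int m" x] by (simp add: mult.commute)
  ultimately show thesis using that[of g] g.add by blast
qed

text \<open>The third claim is the Vieta formula for the sum of the roots. Shifting by
  \<open>pCons 0\<close> puts that coefficient at index \<open>card V\<close>, which avoids a
  subtraction and covers empty \<open>V\<close>.\<close>

lemma prod_linear_coeffs:
  fixes V :: "complex set"
  assumes "finite V"
  shows "coeff (\<Prod>s\<in>V. [:-s, 1:]) (card V) = 1"
    and "\<And>k. card V < k \<Longrightarrow> coeff (\<Prod>s\<in>V. [:-s, 1:]) k = 0"
    and "coeff (pCons 0 (\<Prod>s\<in>V. [:-s, 1:])) (card V) = - \<Sum>V"
  using assms
proof (induction V)
  case (insert s V)
  {
    case 1
    show ?case using insert by simp
  next
    case (2 k)
    then show ?case using insert by (cases k) auto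
  next
    case 3
    show ?case using insert by simp
  }
qed auto

lemma int_coeffs_mult:
  fixes p q :: "complex poly"
  assumes "\<And>k. coeff p k \<in> \<int>" "\<And>k. coeff q k \<in> \<int>" shows "coeff (p * q) k \<in> \<int>"
  unfolding coeff_mult using assms by (intro Ints_sum Ints_mult) auto

lemma int_coeffs_prod:
  fixes p :: "'i \<Rightarrow> complex poly"
  assumes "\<And>i k. i \<in> I \<Longrightarrow> coeff (p i) k \<in> \<int>" shows "coeff (\<Prod>i\<in>I. p i) k \<in> \<int>"
  using assms
proof (induction I arbitrary: k rule: infinite_finite_induct)
  case (insert i I)
  then show ?case by (simp add: int_coeffs_mult)
qed (auto simp: coeff_1)

lemma int_coeffs_linear:
  fixes c d :: complex
  assumes "c \<in> \<int>" "d \<in> \<int>" shows "coeff [:c, d:] k \<in> \<int>"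
  using assms by (cases k; cases "k - 1") (auto simp: coeff_pCons split: nat.splits)

text \<open>\<open>S\<close> is the eigenvalue support of the vertex \<open>a\<close>, and
  \<open>z \<theta>\<close> is the nonzero projection of \<open>axis a 1\<close> to the eigenspace
  of \<open>\<theta>\<close>.\<close>

locale integral_spectrum = hermitian_matrix A
  for A :: "complex ^ 'n ^ 'n" +
  fixes S :: "real set" and z :: "real \<Rightarrow> complex ^ 'n" and a :: 'n
  assumes integral: "A $ i $ j \<in> \<int>"
    and finite_S: "finite S"
    and eigen_z: "\<theta> \<in> S \<Longrightarrow> eigen \<theta> (z \<theta>)"
    and z_nonzero: "\<theta> \<in> S \<Longrightarrow> z \<theta> \<noteq> 0"
    and decomposition: "axis a 1 = (\<Sum>\<theta>\<in>S. z \<theta>)"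
begin

text \<open>The spectral form of the \<open>k\<close>-th iterate of \<open>A\<close> on
  \<open>axis a 1\<close>, which is an integer vector.\<close>

definition moment :: "nat \<Rightarrow> complex ^ 'n" where
  "moment k = (\<Sum>\<theta>\<in>S. of_real \<theta> ^ k *s z \<theta>)"

lemma moment_Suc: "moment (Suc k) = A *v moment k"
  unfolding moment_def matrix_vector_mult_sum
  using eigen_z by (intro sum.cong) (auto simp: eigen_def vector_scalar_commute mult.commute)

lemma moment_integral: "moment k $ w \<in> \<int>"
proof (induction k arbitrary: w)
  case 0
  have "moment 0 = axis a 1" by (simp add: moment_def decomposition)
  then show ?case by (simp add: axis_def)
next
  case (Suc k)
  show ?case unfolding moment_Suc matrix_vector_mult_def
    by (simp add: Ints_sum Ints_mult integral Suc)
qed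

text \<open>Both sides are \<open>p(A^m)\<close> applied to \<open>axis a 1\<close>. The exponent
  \<open>m\<close> is 2 for arguments about squared eigenvalues and 1 for the parity
  argument.\<close>

lemma spectral_poly:
  "(\<Sum>\<theta>\<in>S. poly p (of_real \<theta> ^ m) *s z \<theta>) = (\<Sum>k\<le>degree p. coeff p k *s moment (m * k))"
proof -
  have "(\<Sum>\<theta>\<in>S. poly p (of_real \<theta> ^ m) *s z \<theta>)
      = (\<Sum>\<theta>\<in>S. \<Sum>k\<le>degree p. (coeff p k * of_real \<theta> ^ (m * k)) *s z \<theta>)"
    by (simp add: poly_altdef vec.scale_sum_left power_mult)
  also have "\<dots> = (\<Sum>k\<le>degree p. coeff p k *s moment (m * k))"
    by (subst sum.swap) (simp add: moment_def vec.scale_sum_right)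
  finally show ?thesis .
qed

lemma spectral_poly_integral:
  assumes "\<And>k. coeff p k \<in> \<int>"
  shows "(\<Sum>\<theta>\<in>S. poly p (of_real \<theta> ^ m) *s z \<theta>) $ w \<in> \<int>"
  unfolding spectral_poly by (auto intro!: Ints_sum Ints_mult assms moment_integral)

lemma spectral_coeff_zero:
  assumes "(\<Sum>\<theta>\<in>S. c \<theta> *s z \<theta>) = 0" "\<theta> \<in> S" shows "c \<theta> = 0"
proof -
  have "eigen \<theta> (c \<theta> *s z \<theta>)" if "\<theta> \<in> S" for \<theta>
    using eigen_z[OF that] by (simp add: eigen_def vector_scalar_commute mult.commute)
  from eigen_independent[OF finite_S this assms(1,2)] have "c \<theta> *s z \<theta> = 0" .
  then show ?thesis using z_nonzero[OF assms(2)] by (simp add: vec.scale_eq_0_iff)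
qed

definition squares :: "complex set" where
  "squares = (\<lambda>\<theta>. of_real \<theta> ^ 2) ` S"

lemma finite_squares: "finite squares"
  by (simp add: squares_def finite_S)

text \<open>The coefficients of the monic annihilator \<open>\<Prod>(t - \<theta>\<^sup>2)\<close> of \<open>axis a 1\<close> under \<open>A\<^sup>2\<close> are the only
  solution of a linear system over the integers. A rational-linear \<open>f\<close> with \<open>f 1 = 1\<close> maps solutions to
  solutions, so it fixes them; one of them is minus the sum of the roots.\<close>

lemma functional_fixes_sum_squares:
  assumes add: "\<And>x y. f (x + y) = f x + f y"
    and scale: "\<And>x m. f (x * of_int m) = f x * of_int m" and one: "f 1 = (1 :: complex)"
  shows "f (\<Sum>squares) = \<Sum>squares"
proof -
  define W where "W = (\<Prod>s\<in>squares. [:-s, 1:])"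
  define L where "L = card squares"
  note W = prod_linear_coeffs[OF finite_squares, folded W_def L_def]
  have f0: "f 0 = 0" using scale[of 0 0] by simp
  have f_sum: "f (\<Sum>i\<in>I. x i) = (\<Sum>i\<in>I. f (x i))" for x and I :: "nat set"
    by (induction I rule: infinite_finite_induct) (auto simp: f0 add)
  define W' where "W' = map_poly f W"
  have W'_coeff: "coeff W' k = f (coeff W k)" for k by (simp add: W'_def coeff_map_poly f0)
  have degs: "degree W \<le> L" "degree W' \<le> L"
    using W(2) by (auto intro!: degree_le simp: W'_coeff f0)
  have Ws: "poly W s = 0" if "s \<in> squares" for s
    using that finite_squares by (auto simp: W_def poly_prod)
  have extend: "(\<Sum>k\<le>degree p. coeff p k *s moment (2 * k)) = (\<Sum>k\<le>L. coeff p k *s moment (2 * k))"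
    if "degree p \<le> L" for p :: "complex poly"
    using that by (intro sum.mono_neutral_left) (auto simp: coeff_eq_0)
  have "(\<Sum>k\<le>L. coeff W k *s moment (2 * k)) = (\<Sum>\<theta>\<in>S. poly W (of_real \<theta> ^ 2) *s z \<theta>)"
    by (simp only: spectral_poly extend[OF degs(1)])
  also have "\<dots> = 0" by (intro sum.neutral) (auto simp: Ws squares_def)
  finally have zero: "(\<Sum>k\<le>L. coeff W k *s moment (2 * k)) = 0" .
  \<comment> \<open>Since the moments are integral, \<open>f\<close> passes through them and acts on
    the coefficients alone.\<close>
  have "(\<Sum>k\<le>L. coeff W' k *s moment (2 * k)) $ w = 0" for w
  proof -
    have "f (coeff W k * moment (2 * k) $ w) = coeff W' k * moment (2 * k) $ w" for k
      using moment_integral[of "2 * k" w] scale by (auto simp: W'_coeff elim!: Ints_cases)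
    then have "(\<Sum>k\<le>L. coeff W' k *s moment (2 * k)) $ w = f ((\<Sum>k\<le>L. coeff W k *s moment (2 * k)) $ w)"
      by (simp add: f_sum)
    then show ?thesis by (simp add: zero f0)
  qed
  then have "(\<Sum>\<theta>\<in>S. poly W' (of_real \<theta> ^ 2) *s z \<theta>) = 0"
    by (simp add: spectral_poly extend[OF degs(2)] vec_eq_iff)
  then have W's: "poly W' s = 0" if "s \<in> squares" for s
    using spectral_coeff_zero that by (auto simp: squares_def)
  \<comment> \<open>\<open>f 1 = 1\<close> gives both polynomials the same coefficient at
    \<open>L\<close>, so their difference has degree below \<open>L\<close> but \<open>L\<close>
    distinct roots.\<close>
  have "W - W' = 0"
  proof (rule ccontr)
    assume nz: "W - W' \<noteq> 0"
    have "degree (W - W') \<noteq> L"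
      using nz W(1) leading_coeff_0_iff[of "W - W'"] by (auto simp: W'_coeff one)
    moreover have "degree (W - W') \<le> L" using degs by (rule degree_diff_le)
    moreover have "L \<le> card {x. poly (W - W') x = 0}"
      unfolding L_def using Ws W's by (intro card_mono poly_roots_finite[OF nz]) auto
    ultimately show False using card_poly_roots_bound[OF nz] by linarith
  qed
  then have "coeff W' k = coeff W k" for k by simp
  then have "f (coeff (pCons 0 W) L) = coeff (pCons 0 W) L"
    using W'_coeff f0 by (auto simp: coeff_pCons split: nat.splits)
  then have "f (- \<Sum>squares) = - \<Sum>squares" by (simp only: W(3))
  moreover have "f (- \<Sum>squares) = - f (\<Sum>squares)" using scale[of "\<Sum>squares" "-1"] by simp
  ultimately show ?thesis by simp
qed

text \<open>An integer polynomial in \<open>A^2\<close> that kills all other squares turns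
  \<open>axis a 1\<close> into a nonzero integer vector \<open>y\<close> with
  \<open>A^2 y = s y\<close>. Then all \<open>s^k y\<close> are integral, which bounds the
  denominator of \<open>s\<close>.\<close>

lemma rational_square_integral:
  assumes "squares \<subseteq> \<rat>" "s \<in> squares" shows "s \<in> \<int>"
proof -
  obtain D :: int where D: "D \<noteq> 0" "\<And>t. t \<in> squares \<Longrightarrow> of_int D * t \<in> \<int>"
    using common_denominator[OF finite_squares assms(1)] by auto
  define P where "P = (\<Prod>t\<in>squares - {s}. [:- (of_int D * t), of_int D:])"
  have P_root: "poly P t = 0" if "t \<in> squares" "t \<noteq> s" for t
    using that finite_squares by (auto simp: P_def poly_prod)
  have "poly P s \<noteq> 0"
    using finite_squares D(1) by (auto simp: P_def poly_prod)
  define y where "y = (\<Sum>\<theta>\<in>S. poly P (of_real \<theta> ^ 2) *s z \<theta>)"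
  have "y \<noteq> 0"
    using spectral_coeff_zero[of "\<lambda>\<theta>. poly P (of_real \<theta> ^ 2)"] assms(2) \<open>poly P s \<noteq> 0\<close>
    by (auto simp: y_def squares_def)
  then obtain w where w: "y $ w \<noteq> 0" by (auto simp: vec_eq_iff)
  have "s ^ k * y $ w \<in> \<int>" for k
  proof -
    have "s ^ k *s y = (\<Sum>\<theta>\<in>S. poly (P * monom 1 k) (of_real \<theta> ^ 2) *s z \<theta>)"
      unfolding y_def vec.scale_sum_right
    proof (intro sum.cong refl)
      fix \<theta> assume "\<theta> \<in> S"
      then show "s ^ k *s (poly P (of_real \<theta> ^ 2) *s z \<theta>)
          = poly (P * monom 1 k) (of_real \<theta> ^ 2) *s z \<theta>"
        using P_root[of "of_real \<theta> ^ 2"]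
        by (cases "of_real \<theta> ^ 2 = s") (auto simp: squares_def poly_monom mult.commute)
    qed
    moreover have "coeff (P * monom 1 k) j \<in> \<int>" for j
      unfolding P_def using D(2)
      by (intro int_coeffs_mult int_coeffs_prod int_coeffs_linear) auto
    ultimately have "(s ^ k *s y) $ w \<in> \<int>" by (simp only: spectral_poly_integral)
    then show ?thesis by simp
  qed
  then show ?thesis using rational_powers_integral w assms by blast
qed

text \<open>The distinct squares sum to \<open>h\<^sup>2 m\<close> with a positive integer
  \<open>m\<close>. If \<open>h\<^sup>2\<close> were irrational, a functional killing this sum would
  also fix it. For \<open>h\<^sup>2 = p/q\<close> in lowest terms, integrality of each
  \<open>\<theta>\<^sup>2\<close> makes \<open>q\<close> divide all
  \<open>(n \<theta>)\<^sup>2\<close>, and coprimality leaves \<open>q = 1\<close>.\<close>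

lemma scale_square_integral:
  fixes n :: "real \<Rightarrow> int"
  assumes multiples: "\<And>\<theta>. \<theta> \<in> S \<Longrightarrow> \<theta> = h * of_int (n \<theta>)"
    and coprime: "\<And>r :: int. prime r \<Longrightarrow> \<exists>\<theta>\<in>S. \<not> r dvd n \<theta>"
    and "h \<noteq> 0"
  shows "h\<^sup>2 \<in> \<int>"
proof -
  \<comment> \<open>The sum runs over distinct values of \<open>(n \<theta>)\<^sup>2\<close>,
    because \<open>squares\<close> is a set and \<open>\<theta>\<close>, \<open>- \<theta>\<close>
    contribute once.\<close>
  define m where "m = (\<Sum>i\<in>(\<lambda>\<theta>. (n \<theta>)\<^sup>2) ` S. i)"
  obtain \<theta>0 where \<theta>0: "\<theta>0 \<in> S" "\<not> 2 dvd n \<theta>0" using coprime[of 2] by auto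
  then have "(n \<theta>0)\<^sup>2 \<le> m"
    unfolding m_def using finite_S by (intro member_le_sum) auto
  moreover have "0 < (n \<theta>0)\<^sup>2" using \<theta>0(2) by auto
  ultimately have m: "0 < m" by linarith
  have sq: "of_real \<theta> ^ 2 = complex_of_real (h\<^sup>2) * of_int ((n \<theta>)\<^sup>2)" if "\<theta> \<in> S" for \<theta>
    by (subst multiples[OF that]) (simp add: power_mult_distrib)
  have squares: "squares = (\<lambda>i. complex_of_real (h\<^sup>2) * of_int i) ` (\<lambda>\<theta>. (n \<theta>)\<^sup>2) ` S"
    unfolding squares_def image_image using sq by (intro image_cong) auto
  have "inj_on (\<lambda>i. complex_of_real (h\<^sup>2) * of_int i) X" for X
    using assms(3) by (auto simp: inj_on_def)
  then have sum: "\<Sum>squares = complex_of_real (h\<^sup>2) * of_int m"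
    unfolding squares m_def by (subst sum.reindex) (auto simp: sum_distrib_left)
  have rat: "complex_of_real (h\<^sup>2) \<in> \<rat>"
  proof (rule ccontr)
    assume irr: "complex_of_real (h\<^sup>2) \<notin> \<rat>"
    have sum_irr: "\<Sum>squares \<notin> \<rat>"
    proof
      assume "\<Sum>squares \<in> \<rat>"
      then have "\<Sum>squares / of_int m \<in> \<rat>" by simp
      then show False using irr m by (simp add: sum)
    qed
    obtain f :: "complex \<Rightarrow> complex" where f: "\<And>x y. f (x + y) = f x + f y" "\<And>x m. f (x * of_int m) = f x * of_int m"
      "f 1 = 1" "f (\<Sum>squares) = 0"
      by (rule rational_linear_functional[OF sum_irr]) (rule that)
    have "\<Sum>squares = 0" using functional_fixes_sum_squares[OF f(1-3)] f(4) by simp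
    then show False using sum_irr by simp
  qed
  then obtain p q where pq: "q > 0" "coprime p q" "complex_of_real (h\<^sup>2) = of_int p / of_int q"
    by (auto elim: Rats_cases')
  have "squares \<subseteq> \<rat>" unfolding squares using rat by auto
  have dvd: "q dvd (n \<theta>)\<^sup>2" if "\<theta> \<in> S" for \<theta>
  proof -
    have "of_real \<theta> ^ 2 \<in> squares" using that by (simp add: squares_def)
    then obtain j where "of_real \<theta> ^ 2 = complex_of_int j"
      using rational_square_integral[OF \<open>squares \<subseteq> \<rat>\<close>] by (auto elim: Ints_cases)
    then have "of_int p / of_int q * of_int ((n \<theta>)\<^sup>2) = complex_of_int j"
      unfolding pq(3)[symmetric] using sq[OF that] by (simp only:)
    then have "complex_of_int (p * (n \<theta>)\<^sup>2) = of_int (q * j)"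
      using pq(1) by (simp add: field_simps)
    then have "p * (n \<theta>)\<^sup>2 = q * j" by (simp only: of_int_eq_iff)
    then have "q dvd p * (n \<theta>)\<^sup>2" by simp
    then show ?thesis using pq(2) by (simp add: coprime_dvd_mult_right_iff coprime_commute)
  qed
  have "is_unit q"
  proof (rule ccontr)
    assume "\<not> is_unit q"
    then obtain r where r: "prime r" "r dvd q" using prime_divisorE pq(1) by (metis less_irrefl)
    then obtain \<theta> where "\<theta> \<in> S" "\<not> r dvd n \<theta>" using coprime by blast
    then show False using dvd r by (meson dvd_trans prime_dvd_power)
  qed
  then have "q = 1" using pq(1) by simp
  then have "complex_of_real (h\<^sup>2) = complex_of_real (of_int p)" using pq(3) by simp
  then have "h\<^sup>2 = of_int p" by (simp only: of_real_eq_iff)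
  then show ?thesis by simp
qed

text \<open>The polynomial \<open>\<Prod>(p(\<theta>') - p)\<close>, with \<open>p\<close> the product of \<open>t - \<theta>\<close> over even \<open>\<theta>\<close> and the outer
  product over odd \<open>\<theta>'\<close>, vanishes at the odd eigenvalues and takes the same odd value at all even
  ones; hence an odd multiple of the even part of \<open>axis a 1\<close> is an integer vector.\<close>

lemma parity_split:
  fixes n :: "real \<Rightarrow> int"
  assumes int: "\<And>\<theta>. \<theta> \<in> S \<Longrightarrow> \<theta> = of_int (n \<theta>)"
  shows "(\<Sum>\<theta>\<in>S. (if even (n \<theta>) then 1 else -1) *s z \<theta>) $ a \<noteq> 0"
proof
  define Ev where "Ev = {\<theta>\<in>S. even (n \<theta>)}"
  define Od where "Od = {\<theta>\<in>S. odd (n \<theta>)}"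
  have fin: "finite Ev" "finite Od" using finite_S by (simp_all add: Ev_def Od_def)
  have n: "complex_of_real \<theta> = of_int (n \<theta>)" if "\<theta> \<in> S" for \<theta>
    by (metis int[OF that] of_real_of_int_eq)
  define p :: "complex poly" where "p = (\<Prod>\<theta>\<in>Ev. [:- of_int (n \<theta>), 1:])"
  define v where "v \<theta>' = (\<Prod>\<theta>\<in>Ev. n \<theta>' - n \<theta>)" for \<theta>'
  have p_odd: "poly p (of_real \<theta>') = of_int (v \<theta>')" if "\<theta>' \<in> S" for \<theta>'
    by (simp add: p_def v_def poly_prod n[OF that])
  have p_even: "poly p (of_real \<theta>) = 0" if "\<theta> \<in> Ev" for \<theta>
    using that fin n by (auto simp: p_def poly_prod Ev_def)
  define N where "N = (\<Prod>\<theta>'\<in>Od. v \<theta>')"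
  have "odd N" unfolding N_def v_def using fin by (auto simp: even_prod_iff Od_def Ev_def)
  define Q where "Q = (\<Prod>\<theta>'\<in>Od. [:of_int (v \<theta>'):] - p)"
  have "coeff p k \<in> \<int>" for k unfolding p_def by (intro int_coeffs_prod int_coeffs_linear) auto
  then have Q_int: "coeff Q k \<in> \<int>" for k
    unfolding Q_def
    by (intro int_coeffs_prod) (auto simp: coeff_pCons intro!: Ints_diff split: nat.splits)
  have Q_even: "poly Q (of_real \<theta>) = of_int N" if "\<theta> \<in> Ev" for \<theta>
    using that by (simp add: Q_def N_def poly_prod p_even)
  have Q_odd: "poly Q (of_real \<theta>) = 0" if "\<theta> \<in> Od" for \<theta>
    using that fin p_odd by (auto simp: Q_def poly_prod Od_def)
  have split: "(\<Sum>\<theta>\<in>S. g \<theta>) = (\<Sum>\<theta>\<in>Ev. g \<theta>) + (\<Sum>\<theta>\<in>Od. g \<theta>)" for g :: "real \<Rightarrow> complex ^ 'n"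
  proof -
    have "S = Ev \<union> Od" "Ev \<inter> Od = {}" by (auto simp: Ev_def Od_def)
    then show ?thesis using fin by (simp add: sum.union_disjoint)
  qed
  define e o' where "e = (\<Sum>\<theta>\<in>Ev. z \<theta>)" and "o' = (\<Sum>\<theta>\<in>Od. z \<theta>)"
  \<comment> \<open>Then the even and odd parts agree at \<open>a\<close> and sum to 1, so each
    entry is 1/2; but the odd multiple \<open>N\<close> of 1/2 is not an integer.\<close>
  assume "(\<Sum>\<theta>\<in>S. (if even (n \<theta>) then 1 else -1) *s z \<theta>) $ a = 0"
  moreover have "(\<Sum>\<theta>\<in>S. (if even (n \<theta>) then 1 else -1) *s z \<theta>) = e - o'"
    by (simp add: split e_def o'_def Ev_def Od_def sum_negf)
  moreover have "e + o' = axis a 1" by (simp add: e_def o'_def decomposition split)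
  then have "e $ a + o' $ a = 1" by (metis axis_nth vector_add_component)
  ultimately have half: "e $ a = 1 / 2" by (simp add: field_simps)
  have "(\<Sum>\<theta>\<in>S. poly Q (of_real \<theta> ^ 1) *s z \<theta>) = of_int N *s e"
    by (simp add: split Q_even Q_odd e_def vec.scale_sum_right)
  then have "(of_int N *s e) $ a \<in> \<int>" using spectral_poly_integral[OF Q_int, of 1 a] by simp
  then obtain j where "complex_of_int N * (1 / 2) = of_int j" by (auto simp: half elim: Ints_cases)
  then have "complex_of_int N = of_int (2 * j)" by (simp add: field_simps)
  then have "N = 2 * j" by (simp only: of_int_eq_iff)
  then show False using \<open>odd N\<close> by simp
qed

end

section \<open>Speed limits\<close>

text \<open>Under the speed bound \<open>\<kappa> x - arcsin (q x)\<close> is nondecreasing, while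
  \<open>arcsin q\<close> grows by \<open>pi\<close>. If the time is exactly
  \<open>pi / \<kappa>\<close>, this function is constant and its derivative vanishes.\<close>

lemma speed_limit_strict:
  fixes q q' :: "real \<Rightarrow> real"
  assumes "s < t" "continuous_on {s..t} q"
    and der: "\<And>x. s < x \<Longrightarrow> x < t \<Longrightarrow> (q has_real_derivative q' x) (at x)"
    and speed: "\<And>x. s < x \<Longrightarrow> x < t \<Longrightarrow> \<bar>q' x\<bar> \<le> \<kappa> * sqrt (1 - (q x)\<^sup>2)"
    and inner: "\<And>x. s < x \<Longrightarrow> x < t \<Longrightarrow> \<bar>q x\<bar> < 1"
    and ends: "q s = -1" "q t = 1"
  shows "pi \<le> \<kappa> * (t - s)"
    and "\<lbrakk>\<kappa> * (t - s) = pi; s < x; x < t\<rbrakk> \<Longrightarrow> q' x = \<kappa> * sqrt (1 - (q x)\<^sup>2)"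
proof -
  define F where "F x = \<kappa> * x - arcsin (q x)" for x
  define F' where "F' x = \<kappa> - q' x / sqrt (1 - (q x)\<^sup>2)" for x
  have bnd: "q x \<in> {-1..1}" if "x \<in> {s..t}" for x
    using inner[of x] ends that by (cases "x = s \<or> x = t") auto
  have contF: "continuous_on {s..t} F"
    unfolding F_def using assms(2) bnd by (intro continuous_intros) auto
  have pos: "0 < sqrt (1 - (q x)\<^sup>2)" if "s < x" "x < t" for x
    using inner[OF that] by (simp add: abs_square_less_1)
  have derF: "(F has_real_derivative F' x) (at x)" if "s < x" "x < t" for x
    unfolding F_def F'_def using der[OF that] inner[OF that]
    by (auto intro!: derivative_eq_intros simp: field_simps abs_less_iff)
  have nonneg: "0 \<le> F' x" if "s < x" "x < t" for x
    using speed[OF that] pos[OF that] by (simp add: F'_def field_simps)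
  have mono: "F x \<le> F y" if "s \<le> x" "x \<le> y" "y \<le> t" for x y
  proof (rule DERIV_nonneg_imp_increasing_open[OF that(2)])
    fix u assume "x < u" "u < y"
    then show "\<exists>d. (F has_real_derivative d) (at u) \<and> 0 \<le> d"
      using derF nonneg that by (meson less_le_trans le_less_trans)
  next
    show "continuous_on {x..y} F" using contF that by (auto intro: continuous_on_subset)
  qed
  have Fst: "F t - F s = \<kappa> * (t - s) - pi"
    using ends by (simp add: F_def algebra_simps arcsin_minus_1)
  then show "pi \<le> \<kappa> * (t - s)" using mono[of s t] assms(1) by simp
  assume eq: "\<kappa> * (t - s) = pi" and x: "s < x" "x < t"
  have const: "F y = F s" if "s < y" "y < t" for y
    using mono[of s y] mono[of y t] Fst eq that by simp
  have "(F has_real_derivative 0) (at x)"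
  proof (rule has_field_derivative_transform_within_open[where f = "\<lambda>_. F s" and S = "{s<..<t}"])
    show "((\<lambda>_. F s) has_real_derivative 0) (at x)" by simp
  qed (use const x in auto)
  then have "F' x = 0" using derF[OF x] DERIV_unique by blast
  then show "q' x = \<kappa> * sqrt (1 - (q x)\<^sup>2)" using pos[OF x] by (simp add: F'_def field_simps)
qed

text \<open>Since \<open>arcsin\<close> is not differentiable at the end points, the estimate is made between the last
  visit of \<open>q\<close> to \<open>-1\<close> and the following visit to \<open>1\<close>.\<close>

lemma speed_limit:
  fixes q q' :: "real \<Rightarrow> real"
  assumes "0 < t" "0 < \<kappa>"
    and der: "\<And>x. (q has_real_derivative q' x) (at x)"
    and speed: "\<And>x. \<bar>q' x\<bar> \<le> \<kappa> * sqrt (1 - (q x)\<^sup>2)"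
    and range: "\<And>x. \<bar>q x\<bar> \<le> 1"
    and ends: "q 0 = -1" "q t = 1"
  shows "pi \<le> \<kappa> * t"
    and "\<lbrakk>\<kappa> * t = pi; 0 < x; x < t\<rbrakk> \<Longrightarrow> \<bar>q x\<bar> < 1 \<and> q' x = \<kappa> * sqrt (1 - (q x)\<^sup>2)"
proof -
  have cont: "continuous_on X q" for X
    by (intro continuous_at_imp_continuous_on ballI DERIV_isCont[OF der])
  define S where "S = {0..t} \<inter> q -` {-1}"
  have "compact S"
    unfolding S_def by (intro compact_Int_closed compact_Icc closed_vimage cont) simp
  moreover have "0 \<in> S" using assms(1) ends by (simp add: S_def)
  ultimately obtain s0 where s0: "s0 \<in> S" "\<And>x. x \<in> S \<Longrightarrow> x \<le> s0"
    using compact_attains_sup[of S] by auto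
  define R where "R = {s0..t} \<inter> q -` {1}"
  have "compact R"
    unfolding R_def by (intro compact_Int_closed compact_Icc closed_vimage cont) simp
  moreover have "t \<in> R" using s0 ends by (simp add: R_def S_def)
  ultimately obtain t0 where t0: "t0 \<in> R" "\<And>x. x \<in> R \<Longrightarrow> t0 \<le> x"
    using compact_attains_inf[of R] by auto
  have st: "0 \<le> s0" "s0 < t0" "t0 \<le> t" "q s0 = -1" "q t0 = 1"
    using s0(1) t0(1) by (auto simp: S_def R_def less_le)
  have inner: "\<bar>q x\<bar> < 1" if "s0 < x" "x < t0" for x
    using s0(2)[of x] t0(2)[of x] that st range[of x] by (force simp: S_def R_def abs_le_iff abs_less_iff less_le)
  note lim = speed_limit_strict[OF st(2) cont der speed inner st(4,5)]
  have "pi \<le> \<kappa> * (t0 - s0)" using lim(1) by simp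
  moreover have "\<kappa> * (t0 - s0) \<le> \<kappa> * t" using st assms(2) by (intro mult_left_mono) auto
  ultimately show "pi \<le> \<kappa> * t" by simp
  assume eq: "\<kappa> * t = pi" and x: "0 < x" "x < t"
  \<comment> \<open>In the case of equality there is no time for waiting, so the subinterval is all
    of \<open>{0..t}\<close>.\<close>
  have "\<kappa> * t \<le> \<kappa> * (t0 - s0)" using eq \<open>pi \<le> \<kappa> * (t0 - s0)\<close> by simp
  then have "t \<le> t0 - s0" using assms(2) by simp
  then have "t0 = t" "s0 = 0" using st by auto
  then show "\<bar>q x\<bar> < 1 \<and> q' x = \<kappa> * sqrt (1 - (q x)\<^sup>2)"
    using lim(2)[of x] inner[of x] eq x by simp
qed

section \<open>Probability flow of a Schroedinger evolution on a tree\<close>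

locale tree_walk = tree_relation E for E :: "('v::finite \<times> 'v) set" +
  fixes \<psi> :: "real \<Rightarrow> complex ^ 'v" and a :: 'v
  assumes schroedinger:
      "((\<lambda>t. \<psi> t $ w) has_vector_derivative \<i> * (\<Sum>x | (w, x) \<in> E. \<psi> t $ x)) (at t)"
    and start: "\<psi> 0 = axis a 1"
begin

definition prob :: "'v set \<Rightarrow> real \<Rightarrow> real" where
  "prob B t = (\<Sum>w\<in>B. (cmod (\<psi> t $ w))\<^sup>2)"

text \<open>The probability current into \<open>w\<close> from its neighbour
  \<open>x\<close>.\<close>

definition flux :: "'v \<Rightarrow> 'v \<Rightarrow> real \<Rightarrow> real" where
  "flux w x t = 2 * Re (cnj (\<psi> t $ w) * (\<i> * \<psi> t $ x))"

lemma flux_antisym: "flux w x t = - flux x w t"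
  by (simp add: flux_def)

lemma flux_bound: "\<bar>flux w x t\<bar> \<le> 2 * (cmod (\<psi> t $ w) * cmod (\<psi> t $ x))"
proof -
  have "\<bar>flux w x t\<bar> \<le> 2 * cmod (cnj (\<psi> t $ w) * (\<i> * \<psi> t $ x))"
    unfolding flux_def abs_mult by (intro mult_mono abs_Re_le_cmod) auto
  then show ?thesis by (simp add: norm_mult)
qed

lemma vertex_deriv:
  "((\<lambda>t. (cmod (\<psi> t $ w))\<^sup>2) has_real_derivative (\<Sum>x | (w, x) \<in> E. flux w x t)) (at t)"
proof -
  define d where "d = \<i> * (\<Sum>x | (w, x) \<in> E. \<psi> t $ x)"
  have "((\<lambda>t. Re (\<psi> t $ w)) has_real_derivative Re d) (at t)"
    "((\<lambda>t. Im (\<psi> t $ w)) has_real_derivative Im d) (at t)"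
    using bounded_linear.has_vector_derivative[OF bounded_linear_Re schroedinger[of w t]]
      bounded_linear.has_vector_derivative[OF bounded_linear_Im schroedinger[of w t]]
    by (simp_all only: has_real_derivative_iff_has_vector_derivative d_def)
  from DERIV_add[OF DERIV_power[OF this(1), of 2] DERIV_power[OF this(2), of 2]]
  have "((\<lambda>t. (Re (\<psi> t $ w))\<^sup>2 + (Im (\<psi> t $ w))\<^sup>2)
      has_real_derivative 2 * Re (cnj (\<psi> t $ w) * d)) (at t)"
    by (simp add: algebra_simps)
  moreover have "2 * Re (cnj (\<psi> t $ w) * d) = (\<Sum>x | (w, x) \<in> E. flux w x t)"
    unfolding d_def flux_def sum_distrib_left Re_sum ..
  ultimately show ?thesis by (simp only: cmod_power2)
qed

text \<open>Currents inside \<open>B\<close> cancel in pairs by antisymmetry, so only edges leaving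
  \<open>B\<close> contribute.\<close>

lemma prob_deriv:
  "(prob B has_real_derivative (\<Sum>w\<in>B. \<Sum>x | x \<notin> B \<and> (w, x) \<in> E. flux w x t)) (at t)"
proof -
  define G where "G w x = (if (w, x) \<in> E then flux w x t else 0)" for w x
  have anti: "G w x = - G x w" for w x
    using flux_antisym[of w x t] E_sym[of w x] E_sym[of x w] by (auto simp: G_def)
  have row: "(\<Sum>x | (w, x) \<in> E. flux w x t) = (\<Sum>x\<in>B. G w x) + (\<Sum>x | x \<notin> B \<and> (w, x) \<in> E. flux w x t)"
    for w
  proof -
    have "(\<Sum>x | (w, x) \<in> E. flux w x t) = (\<Sum>x\<in>UNIV. G w x)"
      by (intro sum.mono_neutral_cong_left) (auto simp: G_def)
    also have "\<dots> = (\<Sum>x\<in>B. G w x) + (\<Sum>x\<in>-B. G w x)"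
      by (metis Compl_disjoint Compl_partition finite sum.union_disjoint)
    also have "(\<Sum>x\<in>-B. G w x) = (\<Sum>x | x \<notin> B \<and> (w, x) \<in> E. flux w x t)"
      by (intro sum.mono_neutral_cong_right) (auto simp: G_def)
    finally show ?thesis .
  qed
  have "(\<Sum>w\<in>B. \<Sum>x\<in>B. G w x) = - (\<Sum>w\<in>B. \<Sum>x\<in>B. G x w)"
    by (subst anti) (simp add: sum_negf)
  also have "\<dots> = - (\<Sum>w\<in>B. \<Sum>x\<in>B. G w x)" by (subst sum.swap) simp
  finally have zero: "(\<Sum>w\<in>B. \<Sum>x\<in>B. G w x) = 0" by simp
  have "(prob B has_real_derivative (\<Sum>w\<in>B. \<Sum>x | (w, x) \<in> E. flux w x t)) (at t)"
    unfolding prob_def[abs_def] by (intro DERIV_sum vertex_deriv)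
  then show ?thesis by (simp add: row sum.distrib zero)
qed

lemma prob_side_deriv:
  assumes "(x, y) \<in> E"
  shows "(prob (side x y) has_real_derivative flux y x t) (at t)"
proof -
  have "(\<Sum>w\<in>side x y. \<Sum>v | v \<notin> side x y \<and> (w, v) \<in> E. flux w v t)
      = (\<Sum>w\<in>{y}. \<Sum>v | v \<notin> side x y \<and> (w, v) \<in> E. flux w v t)"
    using side_crossing(1)[OF assms] by (intro sum.mono_neutral_right) (auto intro!: sum.neutral)
  also have "{v. v \<notin> side x y \<and> (y, v) \<in> E} = {x}"
    using side_crossing(2)[OF assms] tail_notin_side[OF assms] E_sym[OF assms] by auto
  then have "(\<Sum>w\<in>{y}. \<Sum>v | v \<notin> side x y \<and> (w, v) \<in> E. flux w v t) = flux y x t" by simp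
  finally show ?thesis using prob_deriv[of "side x y" t] by simp
qed

lemma prob_0: "prob B 0 = (if a \<in> B then 1 else 0)"
proof -
  have "prob B 0 = (\<Sum>w\<in>B. if w = a then 1 else 0)"
    unfolding prob_def start by (intro sum.cong) (auto simp: axis_def)
  then show ?thesis by simp
qed

lemma prob_UNIV: "prob UNIV t = 1"
proof -
  have "(prob UNIV has_real_derivative 0) (at t)" for t
    using prob_deriv[of UNIV t] by simp
  then have "prob UNIV t = prob UNIV 0" by (intro DERIV_isconst_all) auto
  then show ?thesis by (simp add: prob_0)
qed

lemma prob_Compl: "prob (- B) t = 1 - prob B t"
proof -
  have "prob UNIV t = prob B t + prob (- B) t"
    unfolding prob_def by (metis Compl_disjoint Compl_partition finite sum.union_disjoint)
  then show ?thesis by (simp add: prob_UNIV)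
qed

lemma prob_mono: "B \<subseteq> C \<Longrightarrow> prob B t \<le> prob C t"
  unfolding prob_def by (intro sum_mono2) auto

lemma prob_nonneg: "0 \<le> prob B t"
  by (simp add: prob_def sum_nonneg)

lemma prob_le_1: "prob B t \<le> 1"
  using prob_mono[of B UNIV t] by (simp add: prob_UNIV)

lemma prob_point: "w \<in> B \<Longrightarrow> (cmod (\<psi> t $ w))\<^sup>2 \<le> prob B t"
  using prob_mono[of "{w}" B t] by (simp add: prob_def)

lemma amplitude_le: "w \<in> B \<Longrightarrow> cmod (\<psi> t $ w) \<le> sqrt (prob B t)"
  using prob_point by (simp add: real_le_rsqrt)

lemma prob_arrival:
  assumes "cmod (\<psi> t $ b) = 1" "b \<in> B" shows "prob B t = 1"
  using prob_point[OF assms(2), of t] prob_le_1[of B t] assms(1) by simp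

text \<open>A vertex \<open>w\<close> outside \<open>K\<close> carries amplitude zero throughout the
  interval, so the sum of its neighbours' amplitudes vanishes too. If it had a neighbour in
  \<open>K\<close>, that neighbour would be the only one with nonzero amplitude. Hence
  \<open>K\<close> is closed under adjacency.\<close>

lemma support_is_everything:
  assumes "0 < s" "K \<noteq> {}"
    and full: "\<And>t. 0 < t \<Longrightarrow> t < s \<Longrightarrow> prob K t = 1"
    and nonzero: "\<And>t k. 0 < t \<Longrightarrow> t < s \<Longrightarrow> k \<in> K \<Longrightarrow> \<psi> t $ k \<noteq> 0"
    and single: "\<And>w k k'. \<lbrakk>w \<notin> K; k \<in> K; k' \<in> K; (w, k) \<in> E; (w, k') \<in> E\<rbrakk> \<Longrightarrow> k = k'"
  shows "K = UNIV"
proof -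
  have outside: "\<psi> t $ w = 0" if "0 < t" "t < s" "w \<notin> K" for t w
    using prob_point[of w "- K" t] full[OF that(1,2)] that(3) by (simp add: prob_Compl)
  have closed: "w \<in> K" if wk: "(k, w) \<in> E" "k \<in> K" for w k
  proof (rule ccontr)
    assume w: "w \<notin> K"
    define m where "m = s / 2"
    have m: "0 < m" "m < s" using assms(1) by (auto simp: m_def)
    have flat: "((\<lambda>t. \<psi> t $ w) has_vector_derivative 0) (at m)"
      by (rule has_vector_derivative_transform_within_open[where f = "\<lambda>_. 0" and S = "{0<..<s}"])
        (use m outside w in auto)
    have "(\<Sum>x | (w, x) \<in> E. \<psi> m $ x) = 0"
      using vector_derivative_unique_at[OF schroedinger[of w m] flat] by simp
    moreover have "(\<Sum>x | (w, x) \<in> E. \<psi> m $ x) = (\<Sum>x\<in>{k}. \<psi> m $ x)"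
      using single[OF w _ wk(2) _ E_sym[OF wk(1)]] outside[OF m] E_sym[OF wk(1)]
      by (intro sum.mono_neutral_right) auto
    ultimately show False using nonzero[OF m wk(2)] by simp
  qed
  obtain k where k: "k \<in> K" using assms(2) by auto
  have "w \<in> K" for w
    using E_connected[of k w] by (induction rule: rtrancl_induct) (use k closed in auto)
  then show ?thesis by auto
qed

text \<open>The flux through the bridge is at most twice the product of the amplitudes at its ends,
  and these are bounded by the square roots of \<open>P\<close> and \<open>1 - P\<close>.\<close>

lemma one_bridge:
  assumes ay: "(a, y) \<in> E" and b: "b \<in> side a y" and s: "0 < s" "cmod (\<psi> s $ b) = 1"
  shows "pi \<le> 2 * s" and "2 * s = pi \<Longrightarrow> UNIV = {a, y}"
proof -
  define P where "P = prob (side a y)"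
  define q where "q t = 2 * P t - 1" for t
  define q' where "q' t = 2 * flux y a t" for t
  have P: "0 \<le> P t" "P t \<le> 1" for t by (simp_all add: P_def prob_nonneg prob_le_1)
  have der: "(q has_real_derivative q' t) (at t)" for t
    unfolding q_def[abs_def] q'_def P_def
    by (auto intro!: derivative_eq_intros prob_side_deriv[OF ay])
  have amp: "cmod (\<psi> t $ y) \<le> sqrt (P t)" "cmod (\<psi> t $ a) \<le> sqrt (1 - P t)" for t
    using amplitude_le[of y "side a y" t] amplitude_le[of a "- side a y" t] tail_notin_side[OF ay]
    by (simp_all add: P_def prob_Compl)
  have root: "2 * sqrt (1 - (q t)\<^sup>2) = 4 * (sqrt (P t) * sqrt (1 - P t))" for t
  proof -
    have "1 - (q t)\<^sup>2 = 4 * (P t * (1 - P t))" by (simp add: q_def power2_eq_square algebra_simps)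
    then show ?thesis by (simp add: real_sqrt_mult)
  qed
  have speed: "\<bar>q' t\<bar> \<le> 2 * sqrt (1 - (q t)\<^sup>2)" for t
  proof -
    have "\<bar>q' t\<bar> \<le> 4 * (cmod (\<psi> t $ y) * cmod (\<psi> t $ a))"
      using flux_bound[of y a t] by (simp add: q'_def)
    also have "\<dots> \<le> 4 * (sqrt (P t) * sqrt (1 - P t))"
      using amp[of t] P[of t] by (intro mult_left_mono mult_mono) auto
    finally show ?thesis by (simp add: root)
  qed
  have range: "\<bar>q t\<bar> \<le> 1" for t using P[of t] by (simp add: q_def abs_le_iff)
  have ends: "q 0 = -1" "q s = 1"
    using prob_0 tail_notin_side[OF ay] prob_arrival[OF s(2) b] by (simp_all add: q_def P_def)
  note lim = speed_limit[OF s(1) _ der speed range ends]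
  show "pi \<le> 2 * s" using lim(1) by simp
  assume eq: "2 * s = pi"
  \<comment> \<open>Maximal speed leaves no slack in the product of the two amplitude bounds; as
    both bounds are positive, each is attained.\<close>
  have tight: "cmod (\<psi> t $ y) = sqrt (P t) \<and> cmod (\<psi> t $ a) = sqrt (1 - P t) \<and> 0 < P t \<and> P t < 1"
    if "0 < t" "t < s" for t
  proof -
    have q: "\<bar>q t\<bar> < 1" "q' t = 2 * sqrt (1 - (q t)\<^sup>2)" using lim(2)[OF _ eq that] by auto
    then have pos: "0 < P t" "P t < 1" by (auto simp: q_def abs_less_iff)
    then have pos': "0 < sqrt (P t)" "0 < sqrt (1 - P t)" by auto
    have ge: "sqrt (P t) * sqrt (1 - P t) \<le> cmod (\<psi> t $ y) * cmod (\<psi> t $ a)"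
      using q(2) flux_bound[of y a t] by (simp add: root q'_def)
    have "\<not> cmod (\<psi> t $ y) < sqrt (P t)"
      using ge amp[of t] pos' mult_left_mono[OF amp(2)[of t], of "cmod (\<psi> t $ y)"]
        mult_strict_right_mono[of "cmod (\<psi> t $ y)" "sqrt (P t)" "sqrt (1 - P t)"] by fastforce
    moreover have "\<not> cmod (\<psi> t $ a) < sqrt (1 - P t)"
      using ge amp[of t] pos' mult_right_mono[OF amp(1)[of t], of "cmod (\<psi> t $ a)"]
        mult_strict_left_mono[of "cmod (\<psi> t $ a)" "sqrt (1 - P t)" "sqrt (P t)"] by fastforce
    ultimately show ?thesis using amp[of t] pos by auto
  qed
  have "a \<noteq> y" using ay E_irrefl by auto
  have "{a, y} = UNIV"
  proof (rule support_is_everything[OF s(1)])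
    fix t assume t: "0 < t" "t < s"
    show "prob {a, y} t = 1" using tight[OF t] \<open>a \<noteq> y\<close> by (simp add: prob_def)
    show "\<psi> t $ k \<noteq> 0" if "k \<in> {a, y}" for k using tight[OF t] that by auto
  next
    fix w k k' assume "w \<notin> {a, y}" "k \<in> {a, y}" "k' \<in> {a, y}" "(w, k) \<in> E" "(w, k') \<in> E"
    then show "k = k'"
      using no_triangle[OF ay, of w] by auto
  qed simp
  then show "UNIV = {a, y}" by simp
qed

end

text \<open>Here \<open>\<alpha>\<^sup>2\<close>, \<open>\<beta>\<^sup>2\<close>,
  \<open>c\<^sup>2\<close> are the probabilities of the two outer parts and the middle part. The
  squares of the two sides differ by
  \<open>2 * (1 - (\<alpha> + \<beta>)\<^sup>2)\<^sup>2\<close>.\<close>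

lemma two_bridge_inequality:
  fixes \<alpha> \<beta> c :: real
  assumes "\<alpha>\<^sup>2 + \<beta>\<^sup>2 + c\<^sup>2 = 1" "0 \<le> \<alpha>" "0 \<le> \<beta>" "0 \<le> c"
  shows "2 * (c * (\<alpha> + \<beta>)) \<le> sqrt 2 * sqrt (1 - (\<beta>\<^sup>2 - \<alpha>\<^sup>2)\<^sup>2)"
    and "2 * (c * (\<alpha> + \<beta>)) = sqrt 2 * sqrt (1 - (\<beta>\<^sup>2 - \<alpha>\<^sup>2)\<^sup>2) \<Longrightarrow> \<alpha> + \<beta> = 1"
proof -
  have c2: "c\<^sup>2 = 1 - \<alpha>\<^sup>2 - \<beta>\<^sup>2" using assms(1) by simp
  have gap: "2 * (1 - (\<beta>\<^sup>2 - \<alpha>\<^sup>2)\<^sup>2) - (2 * (c * (\<alpha> + \<beta>)))\<^sup>2 = 2 * (1 - (\<alpha> + \<beta>)\<^sup>2)\<^sup>2"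
    unfolding power_mult_distrib c2 by (simp add: power2_eq_square algebra_simps)
  then have "(2 * (c * (\<alpha> + \<beta>)))\<^sup>2 \<le> 2 * (1 - (\<beta>\<^sup>2 - \<alpha>\<^sup>2)\<^sup>2)"
    using zero_le_power2[of "1 - (\<alpha> + \<beta>)\<^sup>2"] by linarith
  then show "2 * (c * (\<alpha> + \<beta>)) \<le> sqrt 2 * sqrt (1 - (\<beta>\<^sup>2 - \<alpha>\<^sup>2)\<^sup>2)"
    unfolding real_sqrt_mult[symmetric] by (rule real_le_rsqrt)
  assume "2 * (c * (\<alpha> + \<beta>)) = sqrt 2 * sqrt (1 - (\<beta>\<^sup>2 - \<alpha>\<^sup>2)\<^sup>2)"
  then have eq: "2 * (c * (\<alpha> + \<beta>)) = sqrt (2 * (1 - (\<beta>\<^sup>2 - \<alpha>\<^sup>2)\<^sup>2))"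
    by (simp only: real_sqrt_mult)
  have "0 \<le> 2 * (1 - (\<beta>\<^sup>2 - \<alpha>\<^sup>2)\<^sup>2)"
    using gap zero_le_power2[of "1 - (\<alpha> + \<beta>)\<^sup>2"] zero_le_power2[of "2 * (c * (\<alpha> + \<beta>))"] by linarith
  then have "(2 * (c * (\<alpha> + \<beta>)))\<^sup>2 = 2 * (1 - (\<beta>\<^sup>2 - \<alpha>\<^sup>2)\<^sup>2)" by (simp add: eq)
  then have "(1 - (\<alpha> + \<beta>)\<^sup>2)\<^sup>2 = 0" using gap by simp
  then have "(\<alpha> + \<beta>)\<^sup>2 = 1" by simp
  then show "\<alpha> + \<beta> = 1" using assms(2,3) by (simp add: power2_eq_1_iff)
qed

context tree_walk begin

text \<open>\<open>q\<close> is the probability beyond both bridges minus that before both, so it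
  moves by the fluxes through both bridges, each bounded using the amplitude at
  \<open>y\<close>.\<close>

lemma two_bridges:
  assumes ay: "(a, y) \<in> E" and yz: "(y, z) \<in> E" and az: "a \<noteq> z"
    and b: "b \<in> side y z" and sub: "side y z \<subseteq> side a y"
    and s: "0 < s" "cmod (\<psi> s $ b) = 1"
  shows "pi \<le> sqrt 2 * s" and "sqrt 2 * s = pi \<Longrightarrow> UNIV = {a, y, z}"
proof -
  define \<alpha> where "\<alpha> t = sqrt (prob (- side a y) t)" for t
  define \<beta> where "\<beta> t = sqrt (prob (side y z) t)" for t
  define c where "c t = sqrt (prob (side a y - side y z) t)" for t
  define q where "q t = prob (side a y) t + prob (side y z) t - 1" for t
  define q' where "q' t = flux y a t + flux z y t" for t
  have nonneg: "0 \<le> \<alpha> t" "0 \<le> \<beta> t" "0 \<le> c t" for t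
    by (simp_all add: \<alpha>_def \<beta>_def c_def prob_nonneg)
  have middle: "prob (side a y - side y z) t = prob (side a y) t - prob (side y z) t" for t
    unfolding prob_def using sub by (simp add: sum_diff)
  have sq: "(\<alpha> t)\<^sup>2 = 1 - prob (side a y) t" "(\<beta> t)\<^sup>2 = prob (side y z) t"
    "(c t)\<^sup>2 = prob (side a y) t - prob (side y z) t" for t
    using prob_nonneg[of "side a y - side y z" t]
    by (simp_all add: \<alpha>_def \<beta>_def c_def prob_nonneg prob_le_1 prob_Compl middle)
  have unit: "(\<alpha> t)\<^sup>2 + (\<beta> t)\<^sup>2 + (c t)\<^sup>2 = 1" for t by (simp add: sq)
  have q: "q t = (\<beta> t)\<^sup>2 - (\<alpha> t)\<^sup>2" for t by (simp add: q_def sq)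
  note ineq = two_bridge_inequality[OF unit nonneg, folded q]
  have der: "(q has_real_derivative q' t) (at t)" for t
    unfolding q_def[abs_def] q'_def
    by (auto intro!: derivative_eq_intros prob_side_deriv[OF ay] prob_side_deriv[OF yz])
  have amp: "cmod (\<psi> t $ a) \<le> \<alpha> t" "cmod (\<psi> t $ z) \<le> \<beta> t" "cmod (\<psi> t $ y) \<le> c t" for t
    using tail_notin_side[OF ay] tail_notin_side[OF yz]
    by (auto simp: \<alpha>_def \<beta>_def c_def intro!: amplitude_le)
  have q'_le: "\<bar>q' t\<bar> \<le> 2 * (cmod (\<psi> t $ y) * (cmod (\<psi> t $ a) + cmod (\<psi> t $ z)))" for t
    using flux_bound[of y a t] flux_bound[of z y t] by (simp add: q'_def algebra_simps)
  have amp_le: "cmod (\<psi> t $ y) * (cmod (\<psi> t $ a) + cmod (\<psi> t $ z)) \<le> c t * (\<alpha> t + \<beta> t)" for t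
    using amp[of t] nonneg[of t] by (intro mult_mono add_mono) auto
  have speed: "\<bar>q' t\<bar> \<le> sqrt 2 * sqrt (1 - (q t)\<^sup>2)" for t
    using q'_le[of t] amp_le[of t] ineq(1)[of t] by linarith
  have range: "\<bar>q t\<bar> \<le> 1" for t
    using prob_le_1[of "side a y" t] prob_nonneg[of "side a y" t]
      prob_le_1[of "side y z" t] prob_nonneg[of "side y z" t] by (simp add: q_def abs_le_iff)
  have "a \<notin> side y z" using tail_notin_side[OF ay] sub by auto
  then have ends: "q 0 = -1" "q s = 1"
    using prob_0 tail_notin_side[OF ay] prob_arrival[OF s(2)] b sub by (auto simp: q_def)
  note lim = speed_limit[OF s(1) _ der speed range ends]
  show "pi \<le> sqrt 2 * s" using lim(1) by simp
  assume eq: "sqrt 2 * s = pi"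
  \<comment> \<open>Equality gives \<open>\<alpha> + \<beta> = 1\<close>; then
    \<open>c \<le> cmod (\<psi> t $ y) * ?r\<close> with factors at most \<open>c\<close> and 1
    forces all amplitude bounds to be attained.\<close>
  have tight: "cmod (\<psi> t $ a) = \<alpha> t \<and> cmod (\<psi> t $ z) = \<beta> t \<and> cmod (\<psi> t $ y) = c t
      \<and> 0 < \<alpha> t \<and> 0 < \<beta> t \<and> 0 < c t"
    if "0 < t" "t < s" for t
  proof -
    have q1: "\<bar>q t\<bar> < 1" "q' t = sqrt 2 * sqrt (1 - (q t)\<^sup>2)" using lim(2)[OF _ eq that] by auto
    have eq1: "2 * (c t * (\<alpha> t + \<beta> t)) = sqrt 2 * sqrt (1 - (q t)\<^sup>2)"
      and ge: "c t * (\<alpha> t + \<beta> t) \<le> cmod (\<psi> t $ y) * (cmod (\<psi> t $ a) + cmod (\<psi> t $ z))"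
      using q'_le[of t] amp_le[of t] ineq(1)[of t] q1(2) by linarith+
    have one: "\<alpha> t + \<beta> t = 1" using ineq(2) eq1 by simp
    have "0 < sqrt (1 - (q t)\<^sup>2)" using q1(1) by (simp add: abs_square_less_1)
    then have "0 < 2 * c t" using eq1 one by (metis mult.right_neutral mult_pos_pos real_sqrt_gt_0_iff zero_less_numeral)
    then have c0: "0 < c t" by simp
    have "\<alpha> t \<noteq> 0" "\<beta> t \<noteq> 0" using one q1(1) by (auto simp: q)
    then have pos: "0 < \<alpha> t" "0 < \<beta> t" using nonneg[of t] by auto
    let ?r = "cmod (\<psi> t $ a) + cmod (\<psi> t $ z)"
    have r: "?r \<le> 1" using amp[of t] one by linarith
    have ge': "c t \<le> cmod (\<psi> t $ y) * ?r" using ge one by simp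
    have "cmod (\<psi> t $ y) * ?r \<le> cmod (\<psi> t $ y) * 1" using r by (intro mult_left_mono) auto
    then have cy: "cmod (\<psi> t $ y) = c t" using ge' amp(3)[of t] by linarith
    then have "1 \<le> ?r" using ge' c0 by simp
    then show ?thesis using cy pos c0 one amp[of t] by linarith
  qed
  have neq: "a \<noteq> y" "y \<noteq> z" using ay yz E_irrefl by auto
  \<comment> \<open>Walking from \<open>z\<close> over \<open>w\<close> to \<open>a\<close> leaves
    \<open>side a y\<close>, which is possible only from \<open>y\<close>.\<close>
  have no_square: "w = y" if "(w, a) \<in> E" "(w, z) \<in> E" for w
    using side_crossing(1)[OF ay, of w a] side_crossing(1)[OF ay, of z w] that E_sym neq sub
      tail_notin_side[OF ay] head_in_side[of z y] by blast
  have "{a, y, z} = UNIV"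
  proof (rule support_is_everything[OF s(1)])
    fix t assume t: "0 < t" "t < s"
    have "prob {a, y, z} t = (\<alpha> t)\<^sup>2 + (c t)\<^sup>2 + (\<beta> t)\<^sup>2"
      using tight[OF t] neq az by (simp add: prob_def)
    then show "prob {a, y, z} t = 1" using unit[of t] by simp
    show "\<psi> t $ k \<noteq> 0" if "k \<in> {a, y, z}" for k using tight[OF t] that by auto
  next
    fix w k k'
    assume "w \<notin> {a, y, z}" "k \<in> {a, y, z}" "k' \<in> {a, y, z}" "(w, k) \<in> E" "(w, k') \<in> E"
    then show "k = k'"
      using no_triangle[OF ay, of w] no_triangle[OF yz, of w] no_square by auto
  qed simp
  then show "UNIV = {a, y, z}" by simp
qed

end

section \<open>Perfect state transfer on a tree\<close>

text \<open>The sign of \<open>g\<close> is prescribed by \<open>P\<close>, so that a unit such as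
  \<open>pi * g / \<tau>\<close> can be made positive for either sign of
  \<open>\<tau>\<close>.\<close>

lemma divide_out_Gcd:
  fixes K :: "'a \<Rightarrow> int"
  assumes "\<theta>0 \<in> S" "K \<theta>0 \<noteq> 0"
  obtains g n where "g \<noteq> 0" "0 < g \<longleftrightarrow> P" "\<And>\<theta>. \<theta> \<in> S \<Longrightarrow> K \<theta> = g * n \<theta>"
    "\<And>r :: int. prime r \<Longrightarrow> \<exists>\<theta>\<in>S. \<not> r dvd n \<theta>"
proof -
  define G where "G = Gcd (K ` S)"
  define g where "g = (if P then G else - G)"
  define n where "n \<theta> = K \<theta> div g" for \<theta>
  have "G \<noteq> 0" using assms by (auto simp: G_def)
  moreover have "0 \<le> G" by (simp add: G_def)
  ultimately have G: "0 < G" by simp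
  have g: "g \<noteq> 0" "0 < g \<longleftrightarrow> P" using G by (auto simp: g_def)
  have K: "K \<theta> = g * n \<theta>" if "\<theta> \<in> S" for \<theta>
  proof -
    have "G dvd K \<theta>" using that by (simp add: G_def)
    then have "g dvd K \<theta>" by (simp add: g_def)
    then show ?thesis by (simp add: n_def)
  qed
  have "\<exists>\<theta>\<in>S. \<not> r dvd n \<theta>" if "prime r" for r :: int
  proof (rule ccontr)
    assume "\<not> (\<exists>\<theta>\<in>S. \<not> r dvd n \<theta>)"
    then have "g * r dvd K \<theta>" if "\<theta> \<in> S" for \<theta> using K that by auto
    then have "g * r dvd G" unfolding G_def by (intro Gcd_greatest) auto
    then have "g * r dvd g" by (auto simp: g_def split: if_splits)
    then show False using g(1) \<open>prime r\<close> by (metis dvd_mult_cancel_left mult.right_neutral not_prime_unit)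
  qed
  with g K show thesis by (rule that)
qed

section \<open>Phases forced by time reversal\<close>

lemma exp_ii_pi_int: "exp (\<i> * of_real (pi * of_int m)) = (if even m then 1 else -1)"
proof -
  have "exp (\<i> * of_real (pi * of_int m)) = of_real (cos (pi * of_int m)) + \<i> * of_real (sin (pi * of_int m))"
    by (simp only: exp_Euler cos_of_real sin_of_real)
  then show ?thesis by (simp only: cos_npi_int sin_npi_int split: if_split) auto
qed

lemma exp_ii_eq_1: "exp (\<i> * of_real x) = 1 \<Longrightarrow> \<exists>k :: int. x = 2 * pi * of_int k"
  by (auto simp: exp_eq_1)

lemma phase_of_even_reversal:
  assumes "exp (\<i> * of_real (- x)) = exp (\<i> * of_real x)"
  obtains k :: int where "x = pi * of_int k"
proof -
  have "exp (\<i> * of_real (2 * x)) = exp (\<i> * of_real x) * exp (\<i> * of_real x)"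
    by (simp add: exp_add[symmetric] algebra_simps)
  also have "\<dots> = exp (\<i> * of_real (- x)) * exp (\<i> * of_real x)" by (simp only: assms)
  also have "\<dots> = 1" by (simp add: exp_add[symmetric] algebra_simps)
  finally obtain k :: int where "2 * x = 2 * pi * of_int k" using exp_ii_eq_1 by blast
  then show thesis using that[of k] by simp
qed

lemma phase_of_odd_reversal:
  assumes "exp (\<i> * of_real (- x)) = - exp (\<i> * of_real x)"
  obtains k :: int where "2 * x = pi * of_int k" "odd k"
proof -
  have "exp (\<i> * of_real (2 * x)) = - (- exp (\<i> * of_real x) * exp (\<i> * of_real x))"
    by (simp add: exp_add[symmetric] algebra_simps)
  also have "\<dots> = - (exp (\<i> * of_real (- x)) * exp (\<i> * of_real x))" by (simp only: assms)
  also have "\<dots> = - 1" by (simp add: exp_add[symmetric] algebra_simps)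
  finally have "exp (\<i> * of_real (2 * x)) = - 1" .
  moreover have "exp (\<i> * of_real (2 * x - pi)) = - exp (\<i> * of_real (2 * x))"
    by (simp add: algebra_simps exp_diff exp_pi_i')
  ultimately have "exp (\<i> * of_real (2 * x - pi)) = 1" by simp
  then obtain k :: int where "2 * x - pi = 2 * pi * of_int k" using exp_ii_eq_1 by blast
  then show thesis using that[of "2 * k + 1"] by (simp add: algebra_simps)
qed

text \<open>For \<open>g = 2 m + 1\<close> the extra factor is \<open>(-1)^(m n)\<close>, which for
  odd \<open>n\<close> depends on \<open>m\<close> only. The two evolutions then differ by a global
  phase.\<close>

lemma quarter_phase:
  fixes g :: int
  assumes "odd g"
  obtains \<sigma> :: complex where "cmod \<sigma> = 1"
    "\<And>n :: int. odd n \<Longrightarrow> exp (\<i> * of_real (pi / 2 * of_int (g * n))) = \<sigma> * exp (\<i> * of_real (pi / 2 * of_int n))"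
proof -
  obtain m where m: "g = 2 * m + 1" using assms by (elim oddE)
  define \<sigma> :: complex where "\<sigma> = (if even m then 1 else - 1)"
  have "exp (\<i> * of_real (pi / 2 * of_int (g * n))) = \<sigma> * exp (\<i> * of_real (pi / 2 * of_int n))"
    if "odd n" for n :: int
  proof -
    have "pi / 2 * of_int (g * n) = pi * of_int (m * n) + pi / 2 * of_int n"
      by (simp add: m field_simps)
    then have "exp (\<i> * of_real (pi / 2 * of_int (g * n)))
        = exp (\<i> * of_real (pi * of_int (m * n))) * exp (\<i> * of_real (pi / 2 * of_int n))"
      by (simp only: of_real_add distrib_left exp_add)
    then show ?thesis unfolding exp_ii_pi_int \<sigma>_def using that by simp
  qed
  moreover have "cmod \<sigma> = 1" by (simp add: \<sigma>_def)
  ultimately show thesis using that by blast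
qed

lemma digraph_iso_path_graph:
  fixes f :: "'v \<Rightarrow> nat"
  assumes "wf_digraph (with_proj T)" "inj f" "f ` pverts T = {..<n}"
    "(\<lambda>(x, y). (f x, f y)) ` parcs T = parcs (path_graph n)"
  shows "digraph_iso (with_proj T) (with_proj (path_graph n))"
proof -
  define h where "h = \<lparr>iso_verts = f, iso_arcs = (\<lambda>(x, y). (f x, f y)), iso_head = snd, iso_tail = fst\<rparr>"
  have "pre_digraph.digraph_isomorphism (with_proj T) h"
    using assms(1,2)
    by (auto simp: pre_digraph.digraph_isomorphism_def h_def inj_on_def)
  moreover have "with_proj (path_graph n) = app_iso h (with_proj T)"
    using assms(3,4) by (simp add: app_iso_def h_def with_proj_def path_graph_def)
  ultimately show ?thesis unfolding digraph_iso_def by blast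
qed

text \<open>The index order makes \<open>a\<close> the column and so the starting vertex: column
  \<open>a\<close> of the transition matrix evolves \<open>axis a 1\<close>.\<close>

locale transfer_on_tree =
  fixes T :: "'v::finite pair_pre_digraph" and a b :: 'v and \<tau> :: real
  assumes graph: "simple_graph T" and tree: "undirected_tree T"
    and pst: "perfect_state_transfer T b a \<tau>"
begin

definition A :: "complex ^ 'v ^ 'v" where
  "A = (\<chi> i j. of_real (adjacency_matrix T $ i $ j))"

sublocale tree_relation "parcs T"
  using graph tree by (rule symmetric_tree_relation)

lemma A_entry: "A $ i $ j = (if (i, j) \<in> parcs T then 1 else 0)"
  by (simp add: A_def adjacency_matrix_def)

sublocale hermitian_matrix A
  by unfold_locales (use E_sym in \<open>auto simp: A_entry\<close>)

lemma A_mult: "(A *v x) $ w = (\<Sum>v | (w, v) \<in> parcs T. x $ v)"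
proof -
  have "(A *v x) $ w = (\<Sum>v\<in>UNIV. if (w, v) \<in> parcs T then x $ v else 0)"
    unfolding matrix_vector_mult_def A_entry by (auto intro!: sum.cong)
  then show ?thesis by (simp add: sum.inter_filter[symmetric])
qed

lemma transition_entry:
  assumes "finite S" "\<And>\<theta>. \<theta> \<in> S \<Longrightarrow> eigen \<theta> (z \<theta>)" "axis u 1 = (\<Sum>\<theta>\<in>S. z \<theta>)"
  shows "transition_matrix T t $ w $ u = (\<Sum>\<theta>\<in>S. exp (\<i> * of_real (t * \<theta>)) * z \<theta> $ w)"
  using matrix_exp_entry[OF assms] by (simp add: transition_matrix_def A_def)

definition \<psi> :: "real \<Rightarrow> complex ^ 'v" where
  "\<psi> t = (\<chi> w. transition_matrix T t $ w $ a)"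

lemma distinct: "a \<noteq> b" and arrival: "cmod (\<psi> \<tau> $ b) = 1"
  using pst by (auto simp: perfect_state_transfer_def \<psi>_def)

text \<open>What is required of a decomposition to express \<open>\<psi>\<close>; kept apart from
  \<open>integral_spectrum\<close> so that it also applies to the sign-reversed
  decomposition.\<close>

definition spectrum :: "real set \<Rightarrow> (real \<Rightarrow> complex ^ 'v) \<Rightarrow> bool" where
  "spectrum S z \<longleftrightarrow> finite S \<and> (\<forall>\<theta>\<in>S. eigen \<theta> (z \<theta>)) \<and> axis a 1 = (\<Sum>\<theta>\<in>S. z \<theta>)"

lemma \<psi>_spectrum:
  assumes "spectrum S z"
  shows "\<psi> t = (\<Sum>\<theta>\<in>S. exp (\<i> * of_real (t * \<theta>)) *s z \<theta>)"
  using transition_entry[of S z a t] assms by (simp add: spectrum_def \<psi>_def vec_eq_iff)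

lemma integral_spectrum_exists: "\<exists>S z. integral_spectrum A S z a"
proof -
  obtain S z where "finite S" "\<And>\<theta>. \<theta> \<in> S \<Longrightarrow> eigen \<theta> (z \<theta>)" "\<And>\<theta>. \<theta> \<in> S \<Longrightarrow> z \<theta> \<noteq> 0"
    "axis a 1 = (\<Sum>\<theta>\<in>S. z \<theta>)"
    by (rule eigen_decomposition[of "axis a 1"]) (rule that)
  then have "integral_spectrum A S z a" by unfold_locales (auto simp: A_entry)
  then show ?thesis by blast
qed

sublocale tree_walk "parcs T" \<psi> a
proof
  obtain S z where "integral_spectrum A S z a" using integral_spectrum_exists by blast
  then interpret integral_spectrum A S z a .
  have sp: "spectrum S z" using finite_S eigen_z decomposition by (simp add: spectrum_def)
  show "\<psi> 0 = axis a 1" using \<psi>_spectrum[OF sp, of 0] decomposition by simp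
  fix w t
  have "((\<lambda>t. \<Sum>\<theta>\<in>S. exp (\<i> * of_real (t * \<theta>)) * z \<theta> $ w) has_vector_derivative
      (\<Sum>\<theta>\<in>S. \<i> * of_real \<theta> * exp (\<i> * of_real (t * \<theta>)) * z \<theta> $ w)) (at t)"
  proof (intro has_vector_derivative_sum)
    fix \<theta>
    have "((\<lambda>x. exp (\<i> * (x * of_real \<theta>)) * z \<theta> $ w) has_field_derivative
        \<i> * of_real \<theta> * exp (\<i> * of_real (t * \<theta>)) * z \<theta> $ w) (at (of_real t))"
      by (auto intro!: derivative_eq_intros)
    from has_vector_derivative_real_field[OF this]
    show "((\<lambda>t. exp (\<i> * of_real (t * \<theta>)) * z \<theta> $ w) has_vector_derivative
        \<i> * of_real \<theta> * exp (\<i> * of_real (t * \<theta>)) * z \<theta> $ w) (at t)" by simp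
  qed
  also have "(\<lambda>t. \<Sum>\<theta>\<in>S. exp (\<i> * of_real (t * \<theta>)) * z \<theta> $ w) = (\<lambda>t. \<psi> t $ w)"
    by (simp add: \<psi>_spectrum[OF sp])
  also have "(\<Sum>\<theta>\<in>S. \<i> * of_real \<theta> * exp (\<i> * of_real (t * \<theta>)) * z \<theta> $ w) = \<i> * (A *v \<psi> t) $ w"
    using eigen_z
    by (simp add: \<psi>_spectrum[OF sp] matrix_vector_mult_sum vector_scalar_commute eigen_def
        sum_distrib_left mult_ac)
  finally show "((\<lambda>t. \<psi> t $ w) has_vector_derivative \<i> * (\<Sum>x | (w, x) \<in> parcs T. \<psi> t $ x)) (at t)"
    by (simp add: A_mult)
qed

lemma arrival_zero: "w \<noteq> b \<Longrightarrow> \<psi> \<tau> $ w = 0"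
  using prob_arrival[OF arrival, of "{b}"] prob_point[of w "- {b}" \<tau>] by (simp add: prob_Compl)

text \<open>Conjugation by the signs of a 2-colouring turns \<open>A\<close> into \<open>-A\<close>, that is, reverses time.\<close>

lemma time_reversal:
  fixes c :: "'v \<Rightarrow> bool"
  assumes c: "\<And>x y. (x, y) \<in> parcs T \<Longrightarrow> c x \<noteq> c y"
  shows "\<psi> (- t) $ w = (if c w = c a then 1 else - 1) * \<psi> t $ w"
proof -
  obtain S z where "integral_spectrum A S z a" using integral_spectrum_exists by blast
  then interpret integral_spectrum A S z a .
  have sp: "spectrum S z" using finite_S eigen_z decomposition by (simp add: spectrum_def)
  \<comment> \<open>The sign is normalised to 1 at \<open>a\<close>, so that the signed components
    still sum to \<open>axis a 1\<close>.\<close>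
  define s :: "'v \<Rightarrow> complex" where "s w = (if c w = c a then 1 else - 1)" for w
  define z' where "z' \<theta> = (\<chi> w. s w * z (- \<theta>) $ w)" for \<theta>
  have "spectrum (uminus ` S) z'"
    unfolding spectrum_def
  proof (intro conjI ballI)
    show "finite (uminus ` S)" using finite_S by simp
    have "(\<Sum>\<theta>\<in>S. z \<theta> $ w) = axis a 1 $ w" for w
      using decomposition by simp
    then show "axis a 1 = (\<Sum>\<theta>\<in>uminus ` S. z' \<theta>)"
      by (auto simp: sum.reindex z'_def vec_eq_iff sum_distrib_left[symmetric] s_def axis_def)
  next
    fix \<theta> assume "\<theta> \<in> uminus ` S"
    then have ev: "A *v z (- \<theta>) = - of_real \<theta> *s z (- \<theta>)"
      using eigen_z[of "- \<theta>"] by (auto simp: eigen_def)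
    have "(A *v z' \<theta>) $ w = of_real \<theta> * z' \<theta> $ w" for w
    proof -
      have "(A *v z' \<theta>) $ w = (\<Sum>v | (w, v) \<in> parcs T. - s w * z (- \<theta>) $ v)"
        unfolding A_mult z'_def by (intro sum.cong) (auto simp: s_def dest: c)
      also have "\<dots> = - s w * (A *v z (- \<theta>)) $ w"
        by (simp add: A_mult sum_distrib_left)
      finally show ?thesis by (simp add: ev z'_def)
    qed
    then show "eigen \<theta> (z' \<theta>)" by (simp add: eigen_def vec_eq_iff)
  qed
  from \<psi>_spectrum[OF this, of t]
  have "\<psi> t $ w = (\<Sum>\<theta>\<in>S. exp (\<i> * of_real (- t * \<theta>)) * (s w * z \<theta> $ w))"
    by (simp add: sum.reindex z'_def)
  also have "\<dots> = s w * \<psi> (- t) $ w"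
    by (simp add: \<psi>_spectrum[OF sp] sum_distrib_left mult_ac)
  finally show ?thesis by (simp add: s_def)
qed

lemma two_or_three_vertices:
  obtains y where "UNIV = {a, y}" "(a, y) \<in> parcs T"
  | y z where "UNIV = {a, y, z}" "(a, y) \<in> parcs T" "(y, z) \<in> parcs T" "a \<noteq> z"
proof -
  obtain c :: "'v \<Rightarrow> bool" where c: "\<And>x y. (x, y) \<in> parcs T \<Longrightarrow> c x \<noteq> c y"
    using two_colouring by auto
  obtain S z where "integral_spectrum A S z a" using integral_spectrum_exists by blast
  then interpret integral_spectrum A S z a .
  have sp: "spectrum S z" using finite_S eigen_z decomposition by (simp add: spectrum_def)
  note \<psi> = \<psi>_spectrum[OF sp]
  have "\<psi> 0 $ b = 0" using start distinct by (simp add: axis_def)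
  then have \<tau>0: "\<tau> \<noteq> 0" using arrival by auto
  \<comment> \<open>At time \<open>\<tau>\<close> only the entry at \<open>b\<close> is nonzero, so
    the vertex-dependent sign of \<open>time_reversal\<close> becomes the constant sign at
    \<open>b\<close>.\<close>
  have reversed: "\<psi> (- \<tau>) = (if c b = c a then 1 else - 1) *s \<psi> \<tau>"
    unfolding vec_eq_iff
  proof
    fix w
    have "\<psi> (- \<tau>) $ w = (if c w = c a then 1 else - 1) * \<psi> \<tau> $ w"
      by (rule time_reversal) (rule c)
    then show "\<psi> (- \<tau>) $ w = ((if c b = c a then 1 else - 1) *s \<psi> \<tau>) $ w"
      using arrival_zero[of w] by (cases "w = b") auto
  qed
  have phases: "exp (\<i> * of_real (- (\<tau> * \<theta>))) = (if c b = c a then 1 else - 1) * exp (\<i> * of_real (\<tau> * \<theta>))"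
    if "\<theta> \<in> S" for \<theta>
  proof -
    let ?\<epsilon> = "if c b = c a then 1 else - 1 :: complex"
    have "(\<Sum>\<theta>\<in>S. (exp (\<i> * of_real (- \<tau> * \<theta>)) - ?\<epsilon> * exp (\<i> * of_real (\<tau> * \<theta>))) *s z \<theta>)
        = \<psi> (- \<tau>) - ?\<epsilon> *s \<psi> \<tau>"
      unfolding \<psi> vec.scale_sum_right sum_subtractf[symmetric]
      by (intro sum.cong refl) (simp add: vec.scale_left_diff_distrib)
    also have "\<dots> = 0" by (simp only: reversed) simp
    finally show ?thesis using spectral_coeff_zero that by fastforce
  qed
  show thesis
  proof (cases "c b = c a")
    case True
    have "\<exists>k :: int. \<tau> * \<theta> = pi * of_int k" if "\<theta> \<in> S" for \<theta>
      using phase_of_even_reversal[of "\<tau> * \<theta>"] phases[OF that] True by auto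
    then obtain K :: "real \<Rightarrow> int" where K: "\<And>\<theta>. \<theta> \<in> S \<Longrightarrow> \<tau> * \<theta> = pi * of_int (K \<theta>)" by metis
    \<comment> \<open>With all \<open>K \<theta>\<close> even, the state would be back at
      \<open>a\<close> at time \<open>\<tau>\<close>.\<close>
    have "\<exists>\<theta>\<in>S. odd (K \<theta>)"
    proof (rule ccontr)
      assume "\<not> (\<exists>\<theta>\<in>S. odd (K \<theta>))"
      then have "exp (\<i> * of_real (\<tau> * \<theta>)) = 1" if "\<theta> \<in> S" for \<theta>
        using that by (simp only: K exp_ii_pi_int) auto
      then have "\<psi> \<tau> = axis a 1" unfolding \<psi> by (simp add: decomposition)
      then show False using arrival distinct by (simp add: axis_def)
    qed
    then obtain \<theta>0 where \<theta>0: "\<theta>0 \<in> S" "odd (K \<theta>0)" by blast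
    then obtain g n where g: "g \<noteq> 0" "0 < g \<longleftrightarrow> 0 < \<tau>" and Kn: "\<And>\<theta>. \<theta> \<in> S \<Longrightarrow> K \<theta> = g * n \<theta>"
      and cop: "\<And>r :: int. prime r \<Longrightarrow> \<exists>\<theta>\<in>S. \<not> r dvd n \<theta>"
      using divide_out_Gcd[of \<theta>0 S K "0 < \<tau>"] by (metis even_zero)
    have "odd g" using Kn[OF \<theta>0(1)] \<theta>0(2) by auto
    define h where "h = pi * of_int g / \<tau>"
    have h0: "0 < h"
      using g \<tau>0 by (cases "0 < \<tau>") (auto simp: h_def zero_less_divide_iff mult_less_0_iff)
    have mult: "\<theta> = h * of_int (n \<theta>)" if "\<theta> \<in> S" for \<theta>
      using K[OF that] \<tau>0 by (simp add: h_def Kn[OF that] field_simps)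
    define s where "s = pi / h"
    have s0: "0 < s" using h0 by (simp add: s_def)
    have s\<theta>: "exp (\<i> * of_real (s * \<theta>)) = (if even (n \<theta>) then 1 else - 1)" if "\<theta> \<in> S" for \<theta>
    proof -
      have "s * \<theta> = pi * of_int (n \<theta>)" using h0 by (subst mult[OF that]) (simp add: s_def)
      then show ?thesis by (simp only: exp_ii_pi_int)
    qed
    \<comment> \<open>As \<open>g\<close> is odd, \<open>n \<theta>\<close> and
      \<open>K \<theta>\<close> have equal parity, so time \<open>s\<close> gives the same state as
      \<open>\<tau>\<close>.\<close>
    have "exp (\<i> * of_real (s * \<theta>)) = exp (\<i> * of_real (\<tau> * \<theta>))" if "\<theta> \<in> S" for \<theta>
      using s\<theta>[OF that] K[OF that] \<open>odd g\<close> by (simp only: exp_ii_pi_int Kn[OF that]) simp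
    then have s\<tau>: "\<psi> s = \<psi> \<tau>" unfolding \<psi> by (intro sum.cong) auto
    \<comment> \<open>For \<open>h = 1\<close> the parity argument gives \<open>\<psi> s\<close> a
      nonzero entry at \<open>a\<close>, yet the whole state sits at \<open>b\<close>.\<close>
    have "h \<noteq> 1"
    proof
      assume "h = 1"
      then have "(\<Sum>\<theta>\<in>S. (if even (n \<theta>) then 1 else -1) *s z \<theta>) $ a \<noteq> 0"
        using mult by (intro parity_split) auto
      moreover have "(\<Sum>\<theta>\<in>S. (if even (n \<theta>) then 1 else -1) *s z \<theta>) = \<psi> s"
        unfolding \<psi> using s\<theta> by (intro sum.cong) auto
      ultimately show False using arrival_zero[OF distinct] s\<tau> by simp
    qed
    have "(a, b) \<notin> parcs T" using c True by blast
    from first_two_edges[OF distinct this] obtain y x where e: "(a, y) \<in> parcs T" "(y, x) \<in> parcs T"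
      "b \<in> side y x" "side y x \<subseteq> side a y" "a \<noteq> x" by blast
    note bound = two_bridges[OF e(1,2,5,3,4) s0, unfolded s\<tau>, OF arrival]
    have "h \<le> sqrt 2" using bound(1) h0 by (simp add: s_def field_simps)
    \<comment> \<open>The positive integer \<open>h\<^sup>2\<close> is at most 2 and not 1, which
      leaves the equality case of the two-bridge bound.\<close>
    then have "h\<^sup>2 \<le> (sqrt 2)\<^sup>2" using h0 by (intro power_mono) auto
    moreover obtain j where j: "h\<^sup>2 = of_int j"
      using scale_square_integral[OF mult cop] h0 by (auto elim: Ints_cases)
    moreover have "0 < h\<^sup>2" "h\<^sup>2 \<noteq> 1" using h0 \<open>h \<noteq> 1\<close> by (auto simp: power2_eq_1_iff)
    ultimately have "j \<le> 2" "0 < j" "j \<noteq> 1" by auto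
    then have "h\<^sup>2 = 2" using j by simp
    then have "h = sqrt 2" using h0 by (metis real_sqrt_abs abs_of_pos)
    then have "sqrt 2 * s = pi" by (simp add: s_def)
    then show thesis using bound(2) e that(2) by blast
  next
    case False
    have "\<exists>k :: int. 2 * (\<tau> * \<theta>) = pi * of_int k \<and> odd k" if "\<theta> \<in> S" for \<theta>
      using phase_of_odd_reversal[of "\<tau> * \<theta>"] phases[OF that] False by auto
    then obtain K :: "real \<Rightarrow> int"
      where K: "\<And>\<theta>. \<theta> \<in> S \<Longrightarrow> 2 * (\<tau> * \<theta>) = pi * of_int (K \<theta>)" "\<And>\<theta>. \<theta> \<in> S \<Longrightarrow> odd (K \<theta>)" by metis
    have "S \<noteq> {}"
    proof
      assume "S = {}"
      then have "axis a 1 = (0 :: complex ^ 'v)" using decomposition by simp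
      then show False by (simp add: axis_eq_0_iff)
    qed
    then obtain \<theta>0 where \<theta>0: "\<theta>0 \<in> S" by blast
    then obtain g n where g: "g \<noteq> 0" "0 < g \<longleftrightarrow> 0 < \<tau>" and Kn: "\<And>\<theta>. \<theta> \<in> S \<Longrightarrow> K \<theta> = g * n \<theta>"
      and cop: "\<And>r :: int. prime r \<Longrightarrow> \<exists>\<theta>\<in>S. \<not> r dvd n \<theta>"
      using divide_out_Gcd[of \<theta>0 S K "0 < \<tau>"] K(2)[OF \<theta>0] by (metis even_zero)
    have "odd g" and n_odd: "\<And>\<theta>. \<theta> \<in> S \<Longrightarrow> odd (n \<theta>)" using Kn K(2) \<theta>0 by (metis even_mult_iff)+
    define h where "h = pi * of_int g / (2 * \<tau>)"
    have h0: "0 < h"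
      using g \<tau>0 by (cases "0 < \<tau>") (auto simp: h_def zero_less_divide_iff mult_less_0_iff)
    have mult: "\<theta> = h * of_int (n \<theta>)" if "\<theta> \<in> S" for \<theta>
      using K(1)[OF that] \<tau>0 by (simp add: h_def Kn[OF that] field_simps)
    define s where "s = pi / (2 * h)"
    have s0: "0 < s" using h0 by (simp add: s_def)
    obtain \<sigma> where \<sigma>: "cmod \<sigma> = 1" "\<And>n :: int. odd n \<Longrightarrow>
        exp (\<i> * of_real (pi / 2 * of_int (g * n))) = \<sigma> * exp (\<i> * of_real (pi / 2 * of_int n))"
      using quarter_phase[OF \<open>odd g\<close>] by blast
    have "exp (\<i> * of_real (\<tau> * \<theta>)) = \<sigma> * exp (\<i> * of_real (s * \<theta>))" if "\<theta> \<in> S" for \<theta>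
    proof -
      have "s * \<theta> = pi / 2 * of_int (n \<theta>)" using h0 by (subst mult[OF that]) (simp add: s_def)
      moreover have "\<tau> * \<theta> = pi / 2 * of_int (g * n \<theta>)" using K(1)[OF that] Kn[OF that] by simp
      ultimately show ?thesis using \<sigma>(2)[OF n_odd[OF that]] by (simp only:)
    qed
    then have "\<psi> \<tau> = \<sigma> *s \<psi> s" unfolding \<psi> vec.scale_sum_right by (intro sum.cong) auto
    then have arr: "cmod (\<psi> s $ b) = 1" using arrival \<sigma>(1) by (simp add: norm_mult)
    obtain y where e: "(a, y) \<in> parcs T" "b \<in> side a y" using first_edge[OF distinct] by blast
    note bound = one_bridge[OF e s0 arr]
    have "h \<le> 1" using bound(1) h0 by (simp add: s_def field_simps)
    obtain j where j: "h\<^sup>2 = of_int j"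
      using scale_square_integral[OF mult cop] h0 by (auto elim: Ints_cases)
    \<comment> \<open>The only positive integer allowed for \<open>h\<^sup>2\<close> is 1, the
      equality case of the one-bridge bound.\<close>
    have "h\<^sup>2 \<le> 1" "0 < h\<^sup>2" using h0 \<open>h \<le> 1\<close> by (auto simp: power_le_one)
    then have "j = 1" using j by simp
    then have "h = 1" using j h0 by (simp add: power2_eq_1_iff)
    then have "2 * s = pi" by (simp add: s_def)
    then show thesis using bound(2) e that(1) by blast
  qed
qed

end

theorem theorem2p1:
  fixes T :: "'v::finite pair_pre_digraph"
  assumes "simple_graph T"
    and "undirected_tree T"
    and "\<not> digraph_iso (with_proj T) (with_proj (path_graph 2))"
    and "\<not> digraph_iso (with_proj T) (with_proj (path_graph 3))"
  shows "\<not> (\<exists>u v (\<tau>::real). perfect_state_transfer T u v \<tau>)"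
proof
  assume "\<exists>u v (\<tau>::real). perfect_state_transfer T u v \<tau>"
  then obtain b a \<tau> where "perfect_state_transfer T b a \<tau>" by blast
  then interpret transfer_on_tree T a b \<tau> using assms(1,2) by unfold_locales
  have verts: "pverts T = UNIV" and "pair_graph T" using assms(1) by (auto simp: simple_graph_def)
  then have wf: "wf_digraph (with_proj T)"
    by (simp add: wf_digraph_wp_iff pair_graph_def pair_digraph_def pair_fin_digraph_def)
  show False
  proof (cases rule: two_or_three_vertices)
    case (1 y)
    define f where "f w = (if w = a then 0 else 1 :: nat)" for w
    have ay: "a \<noteq> y" using 1(2) E_irrefl by auto
    have cases: "w = a \<or> w = y" for w using 1(1) by blast
    have parcs: "parcs T = {(a, y), (y, a)}"
    proof (intro equalityI subrelI)
      fix v w assume "(v, w) \<in> parcs T"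
      then show "(v, w) \<in> {(a, y), (y, a)}" using cases[of v] cases[of w] E_irrefl by auto
    qed (use 1(2) E_sym in auto)
    have "digraph_iso (with_proj T) (with_proj (path_graph 2))"
    proof (rule digraph_iso_path_graph[OF wf])
      show "inj f" using cases by (auto simp: inj_def f_def)
      show "f ` pverts T = {..<2}" unfolding verts 1(1) using ay by (auto simp: f_def)
      show "(\<lambda>(x, y). (f x, f y)) ` parcs T = parcs (path_graph 2)"
        unfolding parcs using ay by (auto simp: f_def path_graph_def)
    qed
    then show False using assms(3) by simp
  next
    case (2 y z)
    define f where "f w = (if w = a then 0 else if w = y then 1 else 2 :: nat)" for w
    have neq: "a \<noteq> y" "y \<noteq> z" "a \<noteq> z" using 2 E_irrefl by auto
    have cases: "w = a \<or> w = y \<or> w = z" for w using 2(1) by blast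
    \<comment> \<open>An edge between \<open>a\<close> and \<open>z\<close> would complete a
      triangle; hence the arcs are those of a path with middle vertex \<open>y\<close>.\<close>
    have az: "(a, z) \<notin> parcs T" "(z, a) \<notin> parcs T"
      using no_triangle[OF 2(3), of a] 2(2) E_sym by blast+
    have parcs: "parcs T = {(a, y), (y, a), (y, z), (z, y)}"
    proof (intro equalityI subrelI)
      fix v w assume "(v, w) \<in> parcs T"
      then show "(v, w) \<in> {(a, y), (y, a), (y, z), (z, y)}"
        using cases[of v] cases[of w] E_irrefl az by auto
    qed (use 2(2,3) E_sym in auto)
    have "digraph_iso (with_proj T) (with_proj (path_graph 3))"
    proof (rule digraph_iso_path_graph[OF wf])
      show "inj f" using cases neq by (auto simp: inj_def f_def)
      show "f ` pverts T = {..<3}" unfolding verts 2(1) using neq by (auto simp: f_def)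
      show "(\<lambda>(x, y). (f x, f y)) ` parcs T = parcs (path_graph 3)"
        unfolding parcs using neq by (auto simp: f_def path_graph_def)
    qed
    then show False using assms(4) by simp
  qed
qed

end
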